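(* Let $\ell \geq 1$ be an integer. Every graph $G$ of order $$n \geq \max\left\{2\kappa(G)\ell+\kappa(G)-2\ell+1,\ 6\kappa(G)+8\ell-4-2\left\lceil \frac{\kappa(G)-2}{\kappa(G)} \right\rceil \right\}$$ with $\delta(G) \geq \frac{n}{2}$ contains $\ell$ pairwise edge-disjoint Hamiltonian cycles $H_1,H_2,\ldots,H_\ell$ such that $\kappa\left(G-\bigcup_{1 \leq i \leq \ell}E(H_i)\right) = \kappa(G)$.
   Context: All graphs are finite, simple and undirected. $\delta(G)$ denotes the minimum degree and $\kappa(G)$ the vertex connectivity of $G$. For $F \subseteq E(G)$, $G-F$ is the graph obtained from $G$ by deleting the edges in $F$ (keeping all vertices). *)

theory Defs
  imports Complex_Main "HOL-Library.Disjoint_Sets" "Graph_Theory.Graph_Theory"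
begin

text \<open>
  Finite simple undirected graphs are the finite symmetric loop-free pair digraphs
  (locale \<^locale>\<open>pair_graph\<close>): an undirected edge \<open>{u, v}\<close> is represented by the two arcs
  \<open>(u, v)\<close> and \<open>(v, u)\<close>. Hence the out-degree of a vertex is its degree.
\<close>

definition min_degree :: "'a pair_pre_digraph \<Rightarrow> nat" where
  "min_degree G = Min (out_degree (with_proj G) ` pverts G)"

text \<open>
  The least number of vertices whose removal leaves a disconnected graph or at most one
  vertex, so the complete graph on \<open>n \<ge> 1\<close> vertices has connectivity \<open>n - 1\<close>.
\<close>

definition vertex_connectivity :: "'a pair_pre_digraph \<Rightarrow> nat" where
  "vertex_connectivity G = (LEAST k. \<exists>S. S \<subseteq> pverts G \<and> card S = k \<and>
     (\<not> Digraph_Component.connected (with_proj G \<restriction> (pverts G - S)) \<or> card (pverts G - S) \<le> 1))"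

text \<open>Undirected edges are compared and deleted as two-element vertex sets.\<close>

definition walk_edges :: "('a \<times> 'a) awalk \<Rightarrow> 'a set set" where
  "walk_edges p = (\<lambda>(u, v). {u, v}) ` set p"

definition del_edges :: "'a pair_pre_digraph \<Rightarrow> 'a set set \<Rightarrow> 'a pair_pre_digraph" where
  "del_edges G F = \<lparr> pverts = pverts G, parcs = {(u, v) \<in> parcs G. {u, v} \<notin> F} \<rparr>"

text \<open>
  In a symmetric digraph \<^const>\<open>pre_digraph.cycle\<close> also accepts the closed walk \<open>u, v, u\<close>,
  which is not a cycle of an undirected graph; the length condition excludes it. The vertices
  of a closed walk are the tails of its arcs.
\<close>

definition hamiltonian_cycle :: "'a pair_pre_digraph \<Rightarrow> ('a \<times> 'a) awalk \<Rightarrow> bool" where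
  "hamiltonian_cycle G p \<longleftrightarrow>
     pre_digraph.cycle (with_proj G) p \<and> 3 \<le> length p \<and> fst ` set p = pverts G"

end

theory Submission
  imports Defs
begin

text \<open>
  Let \<open>S\<close> be a minimum separator, \<open>k = card S\<close>, and let \<open>A\<close>, \<open>B\<close> be the two sides. Writing \<open>\<alpha>\<close>, \<open>\<beta>\<close>
  for the maximal possible number of non-neighbours of a vertex of \<open>A\<close> in \<open>A \<union> S\<close>, and of a vertex
  of \<open>B\<close> in \<open>B \<union> S\<close>, the degree condition gives \<open>\<alpha> + \<beta> \<le> k - 2\<close>, so both sides are almost complete.
  By minimality of \<open>S\<close> and Hall's theorem there are matchings of \<open>S\<close> into \<open>A\<close> and into \<open>B\<close>, that is,
  \<open>k\<close> disjoint paths of length two across \<open>S\<close>. If the Hamiltonian cycles avoid these matchings,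
  the connectivity survives their deletion, since what remains of \<open>A\<close> and \<open>B\<close> is still too dense to
  be separated by fewer than \<open>k\<close> vertices.

  At most \<open>\<alpha>\<close> vertices of \<open>S\<close> have few neighbours in \<open>A\<close> and at most \<open>\<beta>\<close> have few in \<open>B\<close>, so two
  vertices \<open>s\<close>, \<open>t\<close> of \<open>S\<close> have more than \<open>l\<close> neighbours on each side; every Hamiltonian cycle crosses
  from \<open>A\<close> to \<open>B\<close> at \<open>s\<close> and at \<open>t\<close>, along edges reserved in advance. The other vertices of \<open>S\<close> are
  attached greedily to one of the sides, and a Hamiltonian path of each side with the prescribed
  end points is obtained from an arbitrary ordering by exchanging segments.
\<close>

section \<open>Hamiltonian paths with prescribed end points\<close>

text \<open>Termination measure of the exchange argument; it vanishes exactly when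
  \<open>successively R\<close> holds.\<close>

fun defects :: "('a \<Rightarrow> 'a \<Rightarrow> bool) \<Rightarrow> 'a list \<Rightarrow> nat" where
  "defects R (x # y # xs) = (if R x y then 0 else 1) + defects R (y # xs)"
| "defects R _ = 0"

lemma defects_Cons:
  "defects R (x # xs) = (if xs = [] \<or> R x (hd xs) then 0 else 1) + defects R xs"
  by (cases xs) auto

lemma defects_append:
  "defects R (xs @ ys) = defects R xs + defects R ys
     + (if xs = [] \<or> ys = [] \<or> R (last xs) (hd ys) then 0 else 1)"
  by (induction xs) (auto simp: defects_Cons)

lemma defects_rev:
  assumes "symp R"
  shows "defects R (rev xs) = defects R xs"
  by (induction xs) (auto simp: defects_append defects_Cons last_rev dest: sympD[OF assms])

text \<open>Reversing \<open>mid\<close> replaces only the two consecutive pairs at its ends;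
  inside, symmetry of \<open>R\<close> makes the direction irrelevant. Both new pairs are edges and
  at least one old pair was not, so the count drops.\<close>

lemma two_exchange:
  fixes R :: "'a \<Rightarrow> 'a \<Rightarrow> bool" and A :: "'a set"
  defines "P \<equiv> \<lambda>u v. u \<in> A \<and> v \<in> A \<or> R u v"
  assumes sym: "symp R"
    and L: "L = xs @ mid @ ys" "xs \<noteq> []" "mid \<noteq> []" "ys \<noteq> []"
    and P: "successively P L"
    and bad: "\<not> R (last xs) (hd mid) \<or> \<not> R (last mid) (hd ys)"
    and good: "R (last xs) (last mid)" "R (hd mid) (hd ys)"
  shows "successively P (xs @ rev mid @ ys) \<and> defects R (xs @ rev mid @ ys) < defects R L"
proof -
  have flip: "(\<lambda>x y. P y x) = P" using sym by (auto simp: P_def fun_eq_iff dest: sympD)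
  have ends: "hd (rev mid) = last mid" "last (rev mid) = hd mid" "hd (rev mid @ ys) = last mid" "hd (mid @ ys) = hd mid"
    using L(3) by (simp_all add: hd_rev last_rev hd_append)
  have "P (last xs) (last mid)" "P (hd mid) (hd ys)" using good by (simp_all add: P_def)
  moreover have "successively P xs" "successively P (rev mid)" "successively P ys"
    using P unfolding L(1) successively_append_iff successively_rev flip by blast+
  ultimately have "successively P (xs @ rev mid @ ys)"
    unfolding successively_append_iff ends by simp
  moreover have "defects R (xs @ rev mid @ ys) < defects R L"
    unfolding L(1) defects_append defects_rev[OF sym] ends using L(2-4) good bad by simp
  ultimately show ?thesis by blast
qed

lemma split_at_two_indices:
  assumes "i < j" "Suc j < length L"
  obtains xs mid ys where "L = xs @ mid @ ys" "xs \<noteq> []" "mid \<noteq> []" "ys \<noteq> []"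
    "last xs = L ! i" "hd mid = L ! Suc i" "last mid = L ! j" "hd ys = L ! Suc j"
proof (rule that)
  let ?xs = "take (Suc i) L" and ?mid = "take (j - i) (drop (Suc i) L)" and ?ys = "drop (Suc j) L"
  have "drop (Suc i) L = ?mid @ drop (j - i) (drop (Suc i) L)" by (rule append_take_drop_id[symmetric])
  also have "drop (j - i) (drop (Suc i) L) = ?ys" using assms by simp
  finally show "L = ?xs @ ?mid @ ?ys" by (metis append_take_drop_id)
  show "last ?xs = L ! i" using assms by (simp add: take_Suc_conv_app_nth)
  show "hd ?mid = L ! Suc i" using assms by (simp add: hd_drop_conv_nth)
  show "last ?mid = L ! j" using assms by (subst last_conv_nth) auto
  show "hd ?ys = L ! Suc j" using assms by (simp add: hd_drop_conv_nth)
qed (use assms in auto)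

lemma card_nth_vimage_le:
  assumes "distinct L" "finite X"
  shows "card {i. i < length L \<and> L ! i \<in> X} \<le> card X"
  by (rule card_inj_on_le[of "\<lambda>i. L ! i"]) (use assms in \<open>auto simp: inj_on_def nth_eq_iff_index_eq\<close>)

text \<open>
  Every consecutive non-adjacent pair \<open>u, w\<close> admits another consecutive pair \<open>x, y\<close> with edges
  \<open>u x\<close> and \<open>w y\<close>: at most \<open>2 * card J\<close> of the \<open>card A + card J - 1\<close> pairs meet \<open>J\<close>, and at most
  \<open>2 * g\<close> fail because of a missing edge. Reversing the segment in between removes the defect.
\<close>

lemma exchange_step:
  fixes R :: "'a \<Rightarrow> 'a \<Rightarrow> bool" and A J :: "'a set"
  defines "P \<equiv> \<lambda>u v. u \<in> A \<and> v \<in> A \<or> R u v"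
  assumes sym: "symp R" and irr: "\<And>x. \<not> R x x"
    and fin: "finite A" "finite J" and dj: "A \<inter> J = {}"
    and few: "\<And>a. a \<in> A \<Longrightarrow> card {b \<in> A. \<not> R a b} \<le> g"
    and big: "card A > card J + 1 + 2 * g"
    and L: "distinct L" "set L = A \<union> J" "successively P L" "\<not> successively R L"
  obtains L' where "distinct L'" "set L' = A \<union> J" "successively P L'" "hd L' = hd L" "last L' = last L"
    "defects R L' < defects R L"
proof -
  let ?n = "length L"
  obtain i where i: "Suc i < ?n" "\<not> R (L ! i) (L ! Suc i)"
    using L(4) by (auto simp: successively_conv_nth)
  let ?u = "L ! i" and ?w = "L ! Suc i"
  have "P ?u ?w" using L(3) i by (auto simp: successively_conv_nth)
  then have uw: "?u \<in> A" "?w \<in> A" using i by (auto simp: P_def)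
  have len: "?n = card A + card J"
    using L fin dj by (metis card_Un_disjoint distinct_card)
  let ?I = "{j. Suc j < ?n}"
  let ?N = "\<lambda>a. {b \<in> A. \<not> R a b}"
  let ?B = "\<lambda>X. {j. j < ?n \<and> L ! j \<in> X}"
  have cI: "card ?I = ?n - 1"
  proof -
    have "?I = {..<?n - 1}" by auto
    then show ?thesis by simp
  qed
  have Suc_le: "card {j \<in> ?I. L ! Suc j \<in> X} \<le> card X" if "finite X" for X
  proof -
    have "card {j \<in> ?I. L ! Suc j \<in> X} \<le> card (?B X)"
      by (rule card_inj_on_le[of Suc]) auto
    then show ?thesis using card_nth_vimage_le[OF L(1) that] by simp
  qed
  have "\<exists>j\<in>?I. j \<notin> ?B J \<union> {j \<in> ?I. L ! Suc j \<in> J} \<union> ?B (?N ?u) \<union> {j \<in> ?I. L ! Suc j \<in> ?N ?w}"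
    (is "\<exists>j\<in>_. j \<notin> ?F")
  proof (rule ccontr)
    assume "\<not> ?thesis"
    then have "?I \<subseteq> ?F" by blast
    moreover have "finite ?F" by (rule finite_subset[of _ "{..<?n}"]) auto
    ultimately have "card ?I \<le> card ?F" by (rule card_mono[rotated])
    also have "\<dots> \<le> card (?B J) + card {j \<in> ?I. L ! Suc j \<in> J} + card (?B (?N ?u))
        + card {j \<in> ?I. L ! Suc j \<in> ?N ?w}"
      by (intro order_trans[OF card_Un_le] add_mono order_refl)
    also have "\<dots> \<le> card J + card J + card (?N ?u) + card (?N ?w)"
      by (intro add_mono card_nth_vimage_le Suc_le) (use L fin in auto)
    also have "\<dots> \<le> card J + card J + g + g" using few uw by (intro add_mono) auto
    finally show False using cI len big by simp
  qed
  then obtain j where j: "Suc j < ?n" "j \<notin> ?F" by auto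
  have "L ! j \<in> set L" "L ! Suc j \<in> set L" using j(1) by auto
  then have R: "R ?u (L ! j)" "R ?w (L ! Suc j)" using j L(2) by auto
  then have R': "R (L ! j) ?u" "R (L ! Suc j) ?w" using sym by (auto dest: sympD)
  \<comment> \<open>\<open>j = i\<close> would mean \<open>R ?u ?u\<close>. The segment between the
    two pairs is reversed in either order; for \<open>j < i\<close> the new edges are read
    backwards, as in \<open>R'\<close>.\<close>
  have "j \<noteq> i" using R irr by auto
  then consider "i < j" | "j < i" by linarith
  then obtain xs mid ys where s: "L = xs @ mid @ ys" "xs \<noteq> []" "mid \<noteq> []" "ys \<noteq> []"
      "\<not> R (last xs) (hd mid) \<or> \<not> R (last mid) (hd ys)"
      "R (last xs) (last mid)" "R (hd mid) (hd ys)"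
  proof cases
    case 1
    obtain xs mid ys where m: "L = xs @ mid @ ys" "xs \<noteq> []" "mid \<noteq> []" "ys \<noteq> []"
      and e: "last xs = L ! i" "hd mid = L ! Suc i" "last mid = L ! j" "hd ys = L ! Suc j"
      by (rule split_at_two_indices[OF 1 j(1)])
    show ?thesis by (rule that[OF m]) (simp_all add: e i(2) R)
  next
    case 2
    obtain xs mid ys where m: "L = xs @ mid @ ys" "xs \<noteq> []" "mid \<noteq> []" "ys \<noteq> []"
      and e: "last xs = L ! j" "hd mid = L ! Suc j" "last mid = L ! i" "hd ys = L ! Suc i"
      by (rule split_at_two_indices[OF 2 i(1)])
    show ?thesis by (rule that[OF m]) (simp_all add: e i(2) R')
  qed
  let ?L = "xs @ rev mid @ ys"
  have "successively P ?L \<and> defects R ?L < defects R L"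
    unfolding P_def by (rule two_exchange[OF sym s(1-4) L(3)[unfolded P_def] s(5-7)])
  moreover have "distinct ?L" using L(1) unfolding s(1) by auto
  moreover have "set ?L = A \<union> J" using L(2) unfolding s(1) by auto
  moreover have "hd ?L = hd L" "last ?L = last L" using s(2-4) unfolding s(1) by auto
  ultimately show ?thesis by (intro that[of ?L]) blast+
qed

text \<open>Each exchange keeps the vertex set and both end points, and \<open>big\<close> allows
  one as long as a defect is left; hence induction on the number of defects.\<close>

lemma exchange_to_path:
  fixes R :: "'a \<Rightarrow> 'a \<Rightarrow> bool" and A J :: "'a set"
  defines "P \<equiv> \<lambda>u v. u \<in> A \<and> v \<in> A \<or> R u v"
  assumes sym: "symp R" and irr: "\<And>x. \<not> R x x"
    and fin: "finite A" "finite J" and dj: "A \<inter> J = {}"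
    and few: "\<And>a. a \<in> A \<Longrightarrow> card {b \<in> A. \<not> R a b} \<le> g"
    and big: "card A > card J + 1 + 2 * g"
    and L: "distinct L" "set L = A \<union> J" "successively P L"
  shows "\<exists>L'. distinct L' \<and> set L' = A \<union> J \<and> successively R L' \<and> hd L' = hd L \<and> last L' = last L"
  using L
proof (induction "defects R L" arbitrary: L rule: less_induct)
  case less
  show ?case
  proof (cases "successively R L")
    case True
    then show ?thesis using less.prems by blast
  next
    case False
    obtain L' where L': "distinct L'" "set L' = A \<union> J" "successively P L'" "hd L' = hd L"
      "last L' = last L" "defects R L' < defects R L"
      unfolding P_def
      by (rule exchange_step[OF sym irr fin dj few big less.prems[unfolded P_def] False])
    show ?thesis using less.hyps[OF L'(6,1-3)] unfolding L'(4,5) .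
  qed
qed

text \<open>
  Consecutive vertices that both lie in \<open>A\<close> need not be adjacent yet; the exchange argument
  repairs this. The end point \<open>q\<close> is appended only at the very end.
\<close>

definition partial_path ::
  "('a \<Rightarrow> 'a \<Rightarrow> bool) \<Rightarrow> 'a set \<Rightarrow> 'a set \<Rightarrow> 'a \<Rightarrow> 'a \<Rightarrow> 'a list \<Rightarrow> bool" where
  "partial_path R A J p q L \<longleftrightarrow>
     distinct L \<and> J \<subseteq> set L \<and> set L \<subseteq> A \<union> J \<and> q \<notin> set L \<and> card (set L \<inter> A) \<le> 2 * card J \<and>
     successively (\<lambda>u v. u \<in> A \<and> v \<in> A \<or> R u v) L \<and>
     (L \<noteq> [] \<longrightarrow> hd L \<in> A \<and> last L \<in> A) \<and> (p \<in> set L \<longrightarrow> hd L = p)"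

lemma partial_path_Nil: "partial_path R A {} p q []"
  by (simp add: partial_path_def)

section \<open>Growing and completing partial paths\<close>

text \<open>\<open>z\<close> is placed between two neighbours in \<open>A\<close> outside
  \<open>L\<close> and different from \<open>q\<close>. As \<open>L\<close> uses at most
  \<open>2 * card J\<close> vertices of \<open>A\<close>, three more neighbours suffice. The block
  \<open>x, z, y\<close> joins \<open>L\<close> without a new edge, because both have their ends in
  \<open>A\<close>.\<close>

lemma partial_path_insert:
  assumes sym: "symp R" and fin: "finite A" "finite J"
    and L: "partial_path R A J p q L"
    and z: "z \<notin> A" "z \<notin> J" "z \<noteq> q" and p: "p \<in> A"
    and many: "card {a \<in> A. R z a} \<ge> 2 * card J + 3"
  shows "\<exists>L'. partial_path R A (insert z J) p q L'"
proof -
  define N where "N = {a \<in> A. R z a} - (set L \<inter> A) - {q}"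
  have "card {a \<in> A. R z a} \<le> card N + card (set L \<inter> A) + 1"
    using diff_card_le_card_Diff[of "set L \<inter> A" "{a \<in> A. R z a}"]
      diff_card_le_card_Diff[of "{q}" "{a \<in> A. R z a} - (set L \<inter> A)"] unfolding N_def by simp
  then have N: "card N \<ge> 2" using many L by (auto simp: partial_path_def)
  have fN: "finite N" unfolding N_def using fin by simp
  have "N \<noteq> {}" using N by auto
  \<comment> \<open>\<open>x\<close> is \<open>p\<close> whenever \<open>p\<close> is among the
    candidates; the block then goes to the front, so \<open>p\<close> can only enter as the
    head.\<close>
  then obtain x where x: "x \<in> N" "p \<in> N \<Longrightarrow> x = p" by blast
  have "card (N - {x}) \<ge> 1" using N x(1) fN by (simp add: card_Diff_singleton)
  then have "N - {x} \<noteq> {}" by (metis card.empty not_one_le_zero)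
  then obtain y where y: "y \<in> N" "y \<noteq> x" by blast
  have xy: "x \<in> A" "y \<in> A" "R z x" "R x z" "R z y" "x \<notin> set L" "y \<notin> set L" "x \<noteq> q" "y \<noteq> q"
    using x(1) y(1) sym unfolding N_def by (auto dest: sympD)
  have pN: "y \<noteq> p" using x y by auto
  have zL: "z \<notin> set L" using z L by (auto simp: partial_path_def)
  define L' where "L' = (if x = p then [x, z, y] @ L else L @ [x, z, y])"
  have set_L': "set L' = insert x (insert y (insert z (set L)))" by (auto simp: L'_def)
  have "set L' \<inter> A = insert x (insert y (set L \<inter> A))" using xy z set_L' by auto
  then have "card (set L' \<inter> A) \<le> card (set L \<inter> A) + 2"
    by (simp add: card_insert_if)
  then have c: "card (set L' \<inter> A) \<le> 2 * card (insert z J)"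
    using L fin z by (auto simp: partial_path_def)
  let ?P = "\<lambda>u v. u \<in> A \<and> v \<in> A \<or> R u v"
  have LP: "distinct L" "J \<subseteq> set L" "set L \<subseteq> A \<union> J" "q \<notin> set L" "successively ?P L"
    "L \<noteq> [] \<Longrightarrow> hd L \<in> A" "L \<noteq> [] \<Longrightarrow> last L \<in> A" "p \<in> set L \<Longrightarrow> hd L = p"
    using L by (auto simp: partial_path_def)
  have "distinct L'" using LP(1) xy zL y(2) z by (auto simp: L'_def)
  moreover have "successively ?P L'"
    using LP(5-7) xy by (auto simp: L'_def successively_append_iff successively_Cons)
  moreover have "hd L' \<in> A" "last L' \<in> A" using LP(6,7) xy by (auto simp: L'_def hd_append)
  moreover have "hd L' = p" if "p \<in> set L'"
  proof (cases "x = p")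
    case False
    moreover have "p \<in> set L" using that set_L' False pN p z by auto
    ultimately show ?thesis using LP(8) by (auto simp: L'_def hd_append)
  qed (simp add: L'_def)
  moreover have "insert z J \<subseteq> set L'" "set L' \<subseteq> A \<union> insert z J" "q \<notin> set L'"
    using set_L' LP xy z by auto
  ultimately have "partial_path R A (insert z J) p q L'"
    unfolding partial_path_def using c by blast
  then show ?thesis by blast
qed

lemma path_from_partial_path:
  assumes sym: "symp R" and irr: "\<And>x. \<not> R x x"
    and fin: "finite A" "finite J" and dj: "A \<inter> J = {}"
    and few: "\<And>a. a \<in> A \<Longrightarrow> card {b \<in> A. \<not> R a b} \<le> g"
    and big: "card A > card J + 1 + 2 * g"
    and L: "partial_path R A J p q L" and pq: "p \<in> A" "q \<in> A" "p \<noteq> q"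
  shows "\<exists>L'. distinct L' \<and> set L' = A \<union> J \<and> successively R L' \<and> hd L' = p \<and> last L' = q"
proof -
  let ?P = "\<lambda>u v. u \<in> A \<and> v \<in> A \<or> R u v"
  define L1 where "L1 = (if p \<in> set L then L else p # L)"
  have L1: "distinct L1" "set L1 = insert p (set L)" "successively ?P L1" "hd L1 = p" "last L1 \<in> A" "L1 \<noteq> []"
    using L pq unfolding L1_def by (auto simp: partial_path_def successively_Cons)
  obtain rs where rs: "set rs = A - set L1 - {q}" "distinct rs"
    using finite_distinct_list[of "A - set L1 - {q}"] fin by auto
  have "successively ?P xs" if "set xs \<subseteq> A" for xs
    using that by (induction xs) (auto simp: successively_Cons)
  then have "successively ?P rs" using rs(1) by auto
  moreover have in_A: "hd (rs @ [q]) \<in> A" "rs \<noteq> [] \<Longrightarrow> last rs \<in> A"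
    using rs(1) pq hd_in_set[of rs] last_in_set[of rs] by (cases rs; auto)+
  ultimately have "successively ?P (L1 @ rs @ [q])"
    unfolding successively_append_iff using L1(3,5) in_A(1) pq by (auto dest: in_A(2))
  moreover have "distinct (L1 @ rs @ [q])" "set (L1 @ rs @ [q]) = A \<union> J"
    using L L1 rs pq by (auto simp: partial_path_def)
  ultimately have "\<exists>L'. distinct L' \<and> set L' = A \<union> J \<and> successively R L'
      \<and> hd L' = hd (L1 @ rs @ [q]) \<and> last L' = last (L1 @ rs @ [q])"
    by (intro exchange_to_path[OF sym irr fin dj few big])
  then show ?thesis using L1 by simp
qed

text \<open>Greedy choice of a side: with \<open>card J + card K < card Z\<close>, failure of
  \<open>partial_path_insert\<close> on both sides would leave \<open>z\<close> at most
  \<open>2 * (card J + card K) + 4 \<le> 2 * card Z + 2\<close> neighbours in \<open>A\<close> and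
  \<open>B\<close>, contrary to \<open>many\<close>.\<close>

lemma partial_paths_two_sides:
  assumes sym: "symp R" and fin: "finite A" "finite B" "finite Z"
    and dj: "A \<inter> Z = {}" "B \<inter> Z = {}" and q: "q \<in> A" "q' \<in> B" and p: "p \<in> A" "p' \<in> B"
    and many: "\<And>z. z \<in> Z \<Longrightarrow> card {a \<in> A. R z a} + card {b \<in> B. R z b} \<ge> 2 * card Z + 3"
  shows "\<exists>J K L M. J \<union> K = Z \<and> J \<inter> K = {} \<and> partial_path R A J p q L \<and> partial_path R B K p' q' M"
proof -
  let ?ok = "\<lambda>W J K L M. J \<union> K = W \<and> J \<inter> K = {} \<and> partial_path R A J p q L \<and> partial_path R B K p' q' M"
  have "\<exists>J K L M. ?ok W J K L M" if "W \<subseteq> Z" for W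
    using finite_subset[OF that fin(3)] that
  proof (induction W rule: finite_induct)
    case empty
    have "?ok {} {} {} [] []" by (simp add: partial_path_Nil)
    then show ?case by metis
  next
    case (insert z W)
    then have "\<exists>J K L M. ?ok W J K L M" by simp
    then obtain J K L M where IH: "J \<union> K = W" "J \<inter> K = {}" "partial_path R A J p q L" "partial_path R B K p' q' M"
      by (elim exE conjE)
    have fJK: "finite J" "finite K" using IH(1) insert.hyps(1) by auto
    have z: "z \<in> Z" "z \<notin> A" "z \<notin> B" "z \<notin> J" "z \<notin> K" "z \<noteq> q" "z \<noteq> q'"
      using insert.prems insert.hyps(2) IH(1) dj q by auto
    have "card W < card Z" using insert.hyps insert.prems fin(3)
      by (metis insert_subset psubsetI psubset_card_mono)
    moreover have "card W = card J + card K" using card_Un_disjoint[OF fJK IH(2)] IH(1) by simp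
    ultimately consider "card {a \<in> A. R z a} \<ge> 2 * card J + 3" | "card {b \<in> B. R z b} \<ge> 2 * card K + 3"
      using many[OF z(1)] by linarith
    then show ?case
    proof cases
      case 1
      obtain L' where "partial_path R A (insert z J) p q L'"
        using partial_path_insert[OF sym fin(1) fJK(1) IH(3) z(2,4,6) p(1) 1] by blast
      then have "?ok (insert z W) (insert z J) K L' M" using IH z by auto
      then show ?thesis by metis
    next
      case 2
      obtain M' where "partial_path R B (insert z K) p' q' M'"
        using partial_path_insert[OF sym fin(2) fJK(2) IH(4) z(3,5,7) p(2) 2] by blast
      then have "?ok (insert z W) J (insert z K) L M'" using IH z by auto
      then show ?thesis by metis
    qed
  qed
  then show ?thesis by simp
qed

section \<open>Edge-disjoint Hamiltonian closed walks\<close>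

text \<open>Pairing with \<open>rotate1 vs\<close> gives every vertex its cyclic successor,
  including the closing arc.\<close>

abbreviation closed_walk :: "'a list \<Rightarrow> ('a \<times> 'a) awalk" where
  "closed_walk vs \<equiv> zip vs (rotate1 vs)"

lemma in_walk_edges_iff: "{u, v} \<in> walk_edges p \<longleftrightarrow> (u, v) \<in> set p \<or> (v, u) \<in> set p"
  by (force simp: walk_edges_def doubleton_eq_iff)

lemma walk_edgesE:
  assumes "e \<in> walk_edges p"
  obtains u v where "e = {u, v}"
  using assms by (auto simp: walk_edges_def)

lemma successively_imp_zip:
  assumes "successively R (x # xs @ [y])" "(u, v) \<in> set (zip (x # xs) (xs @ [y]))"
  shows "R u v"
  using assms by (induction xs arbitrary: x) auto

lemma closed_walk_arc:
  assumes "successively R (vs @ [hd vs])" "(u, v) \<in> set (closed_walk vs)"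
  shows "R u v"
  using assms successively_imp_zip by (cases vs) fastforce+

lemma closed_walk_edge:
  assumes "symp R" "successively R (vs @ [hd vs])" "{u, v} \<in> walk_edges (closed_walk vs)"
  shows "R u v"
  using assms closed_walk_arc[OF assms(2)] by (auto simp: in_walk_edges_iff dest: sympD)

lemma map_closed_walk [simp]:
  "map fst (closed_walk vs) = vs" "map snd (closed_walk vs) = rotate1 vs"
  by simp_all

lemma distinct_snd_unique:
  assumes "distinct (map snd p)" "(u, x) \<in> set p" "(v, x) \<in> set p"
  shows "u = v"
  using assms inj_onD[of snd "set p" "(u, x)" "(v, x)"] by (simp add: distinct_map)

lemma arc_in_closed_walk:
  assumes "vs = us @ u # v # ws"
  shows "(u, v) \<in> set (closed_walk vs)"
proof -
  have "vs ! length us = u" "rotate1 vs ! length us = v" "length us < length vs"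
    using assms by (auto simp: nth_rotate1 nth_append)
  then show ?thesis unfolding in_set_zip by auto
qed

lemma last_arc_in_closed_walk:
  assumes "vs \<noteq> []"
  shows "(last vs, hd vs) \<in> set (closed_walk vs)"
proof -
  let ?n = "length vs - 1"
  have "vs ! ?n = last vs" "rotate1 vs ! ?n = hd vs" "?n < length vs"
    using assms by (auto simp: nth_rotate1 last_conv_nth hd_conv_nth)
  then show ?thesis unfolding in_set_zip by auto
qed

text \<open>Tails and heads are both distinct, so a vertex has at most one arc out and one arc
  in.\<close>

lemma closed_walk_neighbours:
  assumes "distinct vs"
  shows "finite {u. {v, u} \<in> walk_edges (closed_walk vs)}"
    and "card {u. {v, u} \<in> walk_edges (closed_walk vs)} \<le> 2"
proof -
  let ?p = "closed_walk vs"
  let ?O = "{u. (v, u) \<in> set ?p}" and ?I = "{u. (u, v) \<in> set ?p}"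
  have eq: "{u. {v, u} \<in> walk_edges ?p} = ?O \<union> ?I" by (auto simp: in_walk_edges_iff)
  have d: "distinct (map fst ?p)" "distinct (map snd ?p)" using assms by simp_all
  have f: "finite ?O" "finite ?I"
    by (rule finite_subset[of _ "snd ` set ?p"], force, simp)
      (rule finite_subset[of _ "fst ` set ?p"], force, simp)
  have O1: "card ?O \<le> Suc 0"
    unfolding card_le_Suc0_iff_eq[OF f(1)] using eq_key_imp_eq_value[OF d(1)] by blast
  have I1: "card ?I \<le> Suc 0"
    unfolding card_le_Suc0_iff_eq[OF f(2)] using distinct_snd_unique[OF d(2)] by blast
  show "finite {u. {v, u} \<in> walk_edges ?p}" using eq f by simp
  show "card {u. {v, u} \<in> walk_edges ?p} \<le> 2"
    using O1 I1 card_Un_le[of ?O ?I] unfolding eq by simp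
qed

text \<open>Determines the edges a cycle uses at \<open>s\<close> and \<open>t\<close>, so that
  edges reserved for other cycles stay free. One arc into and one out of each is exhibited;
  distinctness of tails and heads excludes further ones.\<close>

lemma closed_walk_two_paths_neighbours:
  assumes "distinct (s # xs @ t # ys)" "xs \<noteq> []" "ys \<noteq> []"
  shows "{s, u} \<in> walk_edges (closed_walk (s # xs @ t # ys)) \<Longrightarrow> u = hd xs \<or> u = last ys"
    and "{t, u} \<in> walk_edges (closed_walk (s # xs @ t # ys)) \<Longrightarrow> u = last xs \<or> u = hd ys"
proof -
  let ?vs = "s # xs @ t # ys"
  let ?p = "closed_walk ?vs"
  have "distinct (map fst ?p)" "distinct (map snd ?p)"
    using assms(1) by (simp_all only: map_closed_walk distinct1_rotate)
  note unique = eq_key_imp_eq_value[OF this(1)] distinct_snd_unique[OF this(2)]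
  have 1: "(s, hd xs) \<in> set ?p"
    by (rule arc_in_closed_walk[of _ "[]" _ _ "tl xs @ t # ys"]) (simp add: assms)
  have 2: "(last ys, s) \<in> set ?p"
    using last_arc_in_closed_walk[of ?vs] assms by simp
  have 3: "(t, hd ys) \<in> set ?p"
    by (rule arc_in_closed_walk[of _ "s # xs" _ _ "tl ys"]) (simp add: assms)
  have 4: "(last xs, t) \<in> set ?p"
    by (rule arc_in_closed_walk[of _ "s # butlast xs" _ _ ys]) (simp add: assms)
  show "u = hd xs \<or> u = last ys" if "{s, u} \<in> walk_edges ?p"
    using that unique(1)[OF 1] unique(2)[OF 2] unfolding in_walk_edges_iff by blast
  show "u = last xs \<or> u = hd ys" if "{t, u} \<in> walk_edges ?p"
    using that unique(1)[OF 3] unique(2)[OF 4] unfolding in_walk_edges_iff by blast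
qed

lemma pcas_zip: "pcas x (zip (x # xs) (xs @ [y])) y"
  by (induction xs arbitrary: x) auto

text \<open>Passage from vertex lists to the library's cycles: the walk without its first vertex
  visits \<open>rotate1 vs\<close>, which is distinct.\<close>

lemma hamiltonian_cycle_closed_walk:
  assumes "pair_graph G" "distinct vs" "set vs = pverts G" "3 \<le> length vs"
    and "successively (\<lambda>u v. (u, v) \<in> parcs G) (vs @ [hd vs])"
  shows "hamiltonian_cycle G (closed_walk vs)"
proof -
  interpret pair_graph G by fact
  obtain x xs where vs: "vs = x # xs" using assms(4) by (cases vs) auto
  let ?p = "closed_walk vs"
  have cas: "pcas x ?p x" unfolding vs using pcas_zip[of x xs x] by simp
  have "set ?p \<subseteq> parcs G" using closed_walk_arc[OF assms(5)] by auto
  then have "awalk x ?p x" using cas assms(3) vs by (auto simp: awalk_def)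
  moreover have "tl (pawalk_verts x ?p) = rotate1 vs"
    using awalk_verts_conv'[OF cas] vs by simp
  moreover have "?p \<noteq> []" by (simp add: vs)
  ultimately have "cycle ?p" unfolding cycle_def using assms(2) by (metis distinct1_rotate)
  moreover have "fst ` set ?p = set vs" by (metis list.set_map map_closed_walk(1))
  ultimately show ?thesis using assms(3,4) by (simp add: hamiltonian_cycle_def)
qed

section \<open>Hamiltonian cycles through two crossing vertices\<close>

text \<open>The cycle runs from \<open>s\<close> through \<open>A\<close> (from \<open>p\<close> to
  \<open>q\<close>) to \<open>t\<close> and through \<open>B\<close> (from \<open>q'\<close> to
  \<open>p'\<close>) back to \<open>s\<close>; each vertex of \<open>Z\<close> is absorbed by one of
  the two paths.\<close>

lemma hamiltonian_closed_walk_through: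
  assumes sym: "symp R" and irr: "\<And>x. \<not> R x x"
    and fin: "finite A" "finite B" "finite Z"
    and dj: "A \<inter> B = {}" "A \<inter> Z = {}" "B \<inter> Z = {}"
    and st: "s \<noteq> t" "s \<notin> A \<union> B \<union> Z" "t \<notin> A \<union> B \<union> Z"
    and few: "\<And>a. a \<in> A \<Longrightarrow> card {b \<in> A. \<not> R a b} \<le> g" "\<And>b. b \<in> B \<Longrightarrow> card {c \<in> B. \<not> R b c} \<le> h"
    and big: "card A > card Z + 1 + 2 * g" "card B > card Z + 1 + 2 * h"
    and many: "\<And>z. z \<in> Z \<Longrightarrow> card {a \<in> A. R z a} + card {b \<in> B. R z b} \<ge> 2 * card Z + 3"
    and pq: "p \<in> A" "q \<in> A" "p \<noteq> q" "R s p" "R t q"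
    and pq': "p' \<in> B" "q' \<in> B" "p' \<noteq> q'" "R s p'" "R t q'"
  shows "\<exists>vs. distinct vs \<and> set vs = {s, t} \<union> A \<union> B \<union> Z \<and> successively R (vs @ [hd vs]) \<and> 3 \<le> length vs
    \<and> {u. {s, u} \<in> walk_edges (closed_walk vs)} \<subseteq> {p, p'}
    \<and> {u. {t, u} \<in> walk_edges (closed_walk vs)} \<subseteq> {q, q'}"
proof -
  have "\<exists>J K L M. J \<union> K = Z \<and> J \<inter> K = {} \<and> partial_path R A J p q L \<and> partial_path R B K q' p' M"
    by (rule partial_paths_two_sides[OF sym fin dj(2,3) pq(2) pq'(1) pq(1) pq'(2) many])
  then obtain J K L M where JK: "J \<union> K = Z" "J \<inter> K = {}"
    and LM: "partial_path R A J p q L" "partial_path R B K q' p' M"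
    by (elim exE conjE)
  have JKfin: "finite J" "finite K" "A \<inter> J = {}" "B \<inter> K = {}" "card J \<le> card Z" "card K \<le> card Z"
    using JK dj fin by (auto intro: card_mono)
  have bigJK: "card A > card J + 1 + 2 * g" "card B > card K + 1 + 2 * h"
    using big JKfin by linarith+
  have "\<exists>xs. distinct xs \<and> set xs = A \<union> J \<and> successively R xs \<and> hd xs = p \<and> last xs = q"
    by (rule path_from_partial_path[OF sym irr fin(1) JKfin(1,3) few(1) bigJK(1) LM(1) pq(1-3)])
  then obtain xs where xs: "distinct xs" "set xs = A \<union> J" "successively R xs" "hd xs = p" "last xs = q"
    by (elim exE conjE)
  have "\<exists>ys. distinct ys \<and> set ys = B \<union> K \<and> successively R ys \<and> hd ys = q' \<and> last ys = p'"
    by (rule path_from_partial_path[OF sym irr fin(2) JKfin(2,4) few(2) bigJK(2) LM(2) pq'(2,1) pq'(3)[symmetric]])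
  then obtain ys where ys: "distinct ys" "set ys = B \<union> K" "successively R ys" "hd ys = q'" "last ys = p'"
    by (elim exE conjE)
  let ?vs = "s # xs @ t # ys"
  have ne: "xs \<noteq> []" "ys \<noteq> []" using xs(2) ys(2) pq pq' by auto
  have d: "distinct ?vs" using xs ys st dj JK by auto
  have "successively R (?vs @ [hd ?vs])"
    using xs ys ne pq pq' sym by (auto simp: successively_append_iff successively_Cons dest: sympD)
  moreover have "3 \<le> length ?vs" using ne by (cases xs; cases ys) auto
  moreover have "set ?vs = {s, t} \<union> A \<union> B \<union> Z" using xs(2) ys(2) JK(1) by auto
  moreover have "{u. {s, u} \<in> walk_edges (closed_walk ?vs)} \<subseteq> {p, p'}"
    "{u. {t, u} \<in> walk_edges (closed_walk ?vs)} \<subseteq> {q, q'}"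
    using closed_walk_two_paths_neighbours[OF d ne] unfolding xs(4,5) ys(4,5) by blast+
  ultimately show ?thesis using d by (intro exI[of _ ?vs]) blast
qed

lemma card_neighbours_Diff_walks:
  assumes "finite X" "\<And>j. j < m \<Longrightarrow> distinct (vs j)"
  shows "card X \<le> card {u \<in> X. \<forall>j<m. {v, u} \<notin> walk_edges (closed_walk (vs j))} + 2 * m"
    and "card {u \<in> X. \<exists>j<m. {v, u} \<in> walk_edges (closed_walk (vs j))} \<le> 2 * m"
proof -
  let ?N = "\<lambda>j. {u. {v, u} \<in> walk_edges (closed_walk (vs j))}"
  let ?U = "{u \<in> X. \<exists>j<m. {v, u} \<in> walk_edges (closed_walk (vs j))}"
  let ?D = "{u \<in> X. \<forall>j<m. {v, u} \<notin> walk_edges (closed_walk (vs j))}"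
  have "card ?U \<le> card (\<Union>j<m. ?N j)"
    using closed_walk_neighbours(1)[OF assms(2)] by (intro card_mono) auto
  also have "\<dots> \<le> (\<Sum>j<m. card (?N j))" by (rule card_UN_le) simp
  also have "\<dots> \<le> (\<Sum>j<m. 2)"
    using closed_walk_neighbours(2)[OF assms(2)] by (intro sum_mono) auto
  finally show U: "card ?U \<le> 2 * m" by simp
  have "card X = card (?D \<union> ?U)" by (rule arg_cong[of _ _ card]) auto
  then show "card X \<le> card ?D + 2 * m" using U card_Un_le[of ?D ?U] by linarith
qed

text \<open>Induction on the number of cycles found. At most \<open>l - 1\<close> earlier ones cost
  a vertex at most \<open>2 * (l - 1)\<close> edges, which the terms in \<open>l\<close> of
  \<open>big\<close> and \<open>many\<close> absorb; at \<open>s\<close> and \<open>t\<close> the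
  injective families reserve the edges in advance.\<close>

lemma edge_disjoint_closed_walks:
  assumes sym: "symp R" and irr: "\<And>x. \<not> R x x"
    and fin: "finite A" "finite B" "finite Z"
    and dj: "A \<inter> B = {}" "A \<inter> Z = {}" "B \<inter> Z = {}"
    and st: "s \<noteq> t" "s \<notin> A \<union> B \<union> Z" "t \<notin> A \<union> B \<union> Z"
    and few: "\<And>a. a \<in> A \<Longrightarrow> card {b \<in> A. \<not> R a b} \<le> g" "\<And>b. b \<in> B \<Longrightarrow> card {c \<in> B. \<not> R b c} \<le> h"
    and big: "card A + 3 > card Z + 2 * g + 4 * l" "card B + 3 > card Z + 2 * h + 4 * l"
    and many: "\<And>z. z \<in> Z \<Longrightarrow> card {a \<in> A. R z a} + card {b \<in> B. R z b} + 2 \<ge> 2 * card Z + 3 + 2 * l"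
    and p: "inj_on p {..<l}" "inj_on q {..<l}"
      "\<And>i. i < l \<Longrightarrow> p i \<in> A \<and> q i \<in> A \<and> p i \<noteq> q i \<and> R s (p i) \<and> R t (q i)"
    and p': "inj_on p' {..<l}" "inj_on q' {..<l}"
      "\<And>i. i < l \<Longrightarrow> p' i \<in> B \<and> q' i \<in> B \<and> p' i \<noteq> q' i \<and> R s (p' i) \<and> R t (q' i)"
  shows "\<exists>vs. (\<forall>i<l. distinct (vs i) \<and> set (vs i) = {s, t} \<union> A \<union> B \<union> Z
      \<and> successively R (vs i @ [hd (vs i)]) \<and> 3 \<le> length (vs i))
    \<and> disjoint_family_on (\<lambda>i. walk_edges (closed_walk (vs i))) {..<l}"
proof -
  let ?W = "\<lambda>vs. walk_edges (closed_walk vs)"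
  \<comment> \<open>The two inclusions are the invariant that leaves the edges reserved for later
    cycles untouched.\<close>
  define ham where "ham = (\<lambda>i vs. distinct vs \<and> set vs = {s, t} \<union> A \<union> B \<union> Z
    \<and> successively R (vs @ [hd vs]) \<and> 3 \<le> length vs
    \<and> {u. {s, u} \<in> ?W vs} \<subseteq> {p i, p' i} \<and> {u. {t, u} \<in> ?W vs} \<subseteq> {q i, q' i})"
  have "\<exists>vs. (\<forall>i<m. ham i (vs i)) \<and> (\<forall>i<m. \<forall>j<i. ?W (vs i) \<inter> ?W (vs j) = {})" if "m \<le> l" for m
    using that
  proof (induction m)
    case (Suc m)
    from Suc.IH[OF Suc_leD[OF Suc.prems]] obtain vs where vs: "\<And>i. i < m \<Longrightarrow> ham i (vs i)" "\<And>i j. i < m \<Longrightarrow> j < i \<Longrightarrow> ?W (vs i) \<inter> ?W (vs j) = {}"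
      by blast
    have dvs: "distinct (vs j)" if "j < m" for j using vs(1)[OF that] by (simp add: ham_def)
    have W: "u = p j \<or> u = p' j" if "{s, u} \<in> ?W (vs j)" "j < m" for u j
      using vs(1)[OF that(2)] that(1) by (auto simp: ham_def)
    have W': "u = q j \<or> u = q' j" if "{t, u} \<in> ?W (vs j)" "j < m" for u j
      using vs(1)[OF that(2)] that(1) by (auto simp: ham_def)
    define Q where "Q u v \<longleftrightarrow> R u v \<and> (\<forall>j<m. {u, v} \<notin> ?W (vs j))" for u v
    have m: "m < l" using Suc.prems by simp
    have symQ: "symp Q"
    proof (rule sympI)
      fix u v assume "Q u v"
      then show "Q v u" using sympD[OF sym] unfolding Q_def insert_commute[of v u] by blast
    qed
    have fewQ: "card {b \<in> X. \<not> Q a b} \<le> c + 2 * (l - 1)"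
      if "finite X" "card {b \<in> X. \<not> R a b} \<le> c" for X a c
    proof -
      have eq: "{b \<in> X. \<not> Q a b} = {b \<in> X. \<not> R a b} \<union> {b \<in> X. \<exists>j<m. {a, b} \<in> ?W (vs j)}"
        by (auto simp: Q_def)
      have "card {b \<in> X. \<not> Q a b} \<le> card {b \<in> X. \<not> R a b} + card {b \<in> X. \<exists>j<m. {a, b} \<in> ?W (vs j)}"
        unfolding eq by (rule card_Un_le)
      also have "\<dots> \<le> c + 2 * m"
        by (rule add_mono[OF that(2) card_neighbours_Diff_walks(2)[OF that(1) dvs]])
      finally show ?thesis using m by linarith
    qed
    have manyQ: "card {a \<in> A. Q z a} + card {b \<in> B. Q z b} \<ge> 2 * card Z + 3" if "z \<in> Z" for z
    proof -
      let ?X = "{a \<in> A. R z a} \<union> {b \<in> B. R z b}"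
      have "card ?X = card {a \<in> A. R z a} + card {b \<in> B. R z b}"
        using fin dj by (intro card_Un_disjoint) auto
      moreover have "card ?X \<le> card {u \<in> ?X. \<forall>j<m. {z, u} \<notin> ?W (vs j)} + 2 * m"
        by (rule card_neighbours_Diff_walks(1)[OF _ dvs]) (use fin in simp_all)
      moreover have "card {u \<in> ?X. \<forall>j<m. {z, u} \<notin> ?W (vs j)} = card ({a \<in> A. Q z a} \<union> {b \<in> B. Q z b})"
        by (rule arg_cong[of _ _ card]) (auto simp: Q_def)
      moreover have "card ({a \<in> A. Q z a} \<union> {b \<in> B. Q z b}) \<le> card {a \<in> A. Q z a} + card {b \<in> B. Q z b}"
        by (rule card_Un_le)
      ultimately show ?thesis using many[OF that] m by linarith
    qed
    have neq: "p m \<noteq> p j" "q m \<noteq> q j" "p' m \<noteq> p' j" "q' m \<noteq> q' j" if "j < m" for j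
      using that m inj_onD[OF p(1), of m j] inj_onD[OF p(2), of m j]
        inj_onD[OF p'(1), of m j] inj_onD[OF p'(2), of m j] by auto
    have neq': "p m \<noteq> p' j" "q m \<noteq> q' j" "p' m \<noteq> p j" "q' m \<noteq> q j" if "j < m" for j
      using that m p(3)[of m] p'(3)[of m] p(3)[of j] p'(3)[of j] dj(1) by auto
    note pm = p(3)[OF m] note pm' = p'(3)[OF m]
    \<comment> \<open>Earlier cycles meet \<open>s\<close> only at \<open>p j\<close>,
      \<open>p' j\<close> and \<open>t\<close> only at \<open>q j\<close>, \<open>q' j\<close>,
      which differ from the end points that \<open>m\<close> assigns to the same vertex.\<close>
    have ends: "Q s (p m)" "Q s (p' m)" "Q t (q m)" "Q t (q' m)"
      unfolding Q_def using pm pm' W W' neq neq' by metis+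
    have irrQ: "\<not> Q x x" for x using irr by (simp add: Q_def)
    have bigQ: "card A > card Z + 1 + 2 * (g + 2 * (l - 1))" "card B > card Z + 1 + 2 * (h + 2 * (l - 1))"
      using big m by (cases l; simp)+
    have "\<exists>ws. distinct ws \<and> set ws = {s, t} \<union> A \<union> B \<union> Z \<and> successively Q (ws @ [hd ws]) \<and> 3 \<le> length ws
      \<and> {u. {s, u} \<in> ?W ws} \<subseteq> {p m, p' m} \<and> {u. {t, u} \<in> ?W ws} \<subseteq> {q m, q' m}"
      by (rule hamiltonian_closed_walk_through[OF symQ irrQ fin dj st fewQ[OF fin(1) few(1)]
          fewQ[OF fin(2) few(2)] bigQ manyQ])
        (use ends pm pm' in simp_all)
    then obtain ws where ws: "distinct ws" "set ws = {s, t} \<union> A \<union> B \<union> Z" "successively Q (ws @ [hd ws])" "3 \<le> length ws"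
      "{u. {s, u} \<in> ?W ws} \<subseteq> {p m, p' m}" "{u. {t, u} \<in> ?W ws} \<subseteq> {q m, q' m}"
      by (elim exE conjE)
    have Qws: "Q u v" if "{u, v} \<in> ?W ws" for u v
      using closed_walk_edge[OF symQ ws(3) that] .
    have "e \<notin> ?W (vs j)" if e: "e \<in> ?W ws" "j < m" for e j
    proof -
      obtain u v where "e = {u, v}" by (rule walk_edgesE[OF e(1)])
      then show ?thesis using Qws[of u v] e by (auto simp: Q_def)
    qed
    then have dis: "?W ws \<inter> ?W (vs j) = {}" if "j < m" for j using that by blast
    have "successively R (ws @ [hd ws])"
      using ws(3) by (rule successively_mono) (simp add: Q_def)
    then have "ham m ws" using ws unfolding ham_def by blast
    then have "ham i ((vs(m := ws)) i)" if "i < Suc m" for i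
      using vs(1)[of i] that by (cases "i = m") auto
    moreover have "?W ((vs(m := ws)) i) \<inter> ?W ((vs(m := ws)) j) = {}" if "i < Suc m" "j < i" for i j
      using vs(2)[of i j] dis[of j] that by (cases "i = m") auto
    ultimately show ?case by (intro exI[of _ "vs(m := ws)"]) blast
  qed simp
  from this[OF order_refl] obtain vs
    where vs: "\<And>i. i < l \<Longrightarrow> ham i (vs i)" "\<And>i j. i < l \<Longrightarrow> j < i \<Longrightarrow> ?W (vs i) \<inter> ?W (vs j) = {}"
    by blast
  have "disjoint_family_on (\<lambda>i. ?W (vs i)) {..<l}"
    unfolding disjoint_family_on_def
  proof (intro ballI impI)
    fix i j :: nat assume "i \<in> {..<l}" "j \<in> {..<l}" "i \<noteq> j"
    then consider "i < l" "j < i" | "j < l" "i < j" by fastforce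
    then show "?W (vs i) \<inter> ?W (vs j) = {}" using vs(2) by cases blast+
  qed
  then show ?thesis using vs(1) unfolding ham_def by blast
qed

section \<open>Distinct representatives\<close>

text \<open>
  Rado's proof: as long as some \<open>N i\<close> has two elements, one of them can be removed without
  violating the condition, by submodularity of \<open>\<lambda>X. card (\<Union> (N ` X))\<close>.
\<close>

lemma hall_matching:
  assumes "finite I" "\<And>i. i \<in> I \<Longrightarrow> finite (N i)" "\<And>X. X \<subseteq> I \<Longrightarrow> card X \<le> card (\<Union> (N ` X))"
  shows "\<exists>f. inj_on f I \<and> (\<forall>i\<in>I. f i \<in> N i)"
  using assms(2,3)
proof (induction "\<Sum>i\<in>I. card (N i)" arbitrary: N rule: less_induct)
  case less
  note hall = less.prems(2)
  show ?case
  proof (cases "\<forall>i\<in>I. card (N i) \<le> 1")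
    case True
    \<comment> \<open>Hall's condition for one index makes \<open>N i\<close> nonempty; below, for
      two indices, it makes the elements distinct.\<close>
    have single: "N i = {the_elem (N i)}" if "i \<in> I" for i
    proof -
      have "card (N i) = 1" using hall[of "{i}"] True that by force
      then show ?thesis by (metis card_1_singletonE the_elem_eq)
    qed
    have "inj_on (\<lambda>i. the_elem (N i)) I"
    proof (rule inj_onI, rule ccontr)
      fix i j assume ij: "i \<in> I" "j \<in> I" "the_elem (N i) = the_elem (N j)" "i \<noteq> j"
      have "N i = N j" using single[OF ij(1)] single[OF ij(2)] ij(3) by simp
      then have "\<Union> (N ` {i, j}) = {the_elem (N i)}" using single[OF ij(1)] by simp
      then show False using hall[of "{i, j}"] ij by simp
    qed
    then show ?thesis using single by blast
  next
    case False
    then obtain k where k: "k \<in> I" "\<not> card (N k) \<le> 1" by auto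
    then obtain x y where xy: "x \<in> N k" "y \<in> N k" "x \<noteq> y"
      using less.prems(1)[OF k(1)] by (metis One_nat_def card_le_Suc0_iff_eq)
    define D where "D v = N(k := N k - {v})" for v
    have fN: "finite (\<Union> (N ` X))" if "X \<subseteq> I" for X
      using that assms(1) less.prems(1) by (meson finite_UN_I finite_subset subsetD)
    show ?thesis
    proof (cases "\<exists>v\<in>N k. \<forall>X\<subseteq>I. card X \<le> card (\<Union> (D v ` X))")
      case True
      then obtain v where v: "v \<in> N k" "\<And>X. X \<subseteq> I \<Longrightarrow> card X \<le> card (\<Union> (D v ` X))" by blast
      have "(\<Sum>i\<in>I. card (D v i)) < (\<Sum>i\<in>I. card (N i))"
      proof (rule sum_strict_mono_ex1[OF assms(1)])
        show "\<forall>i\<in>I. card (D v i) \<le> card (N i)"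
          using less.prems(1) by (auto simp: D_def intro: card_mono)
        show "\<exists>i\<in>I. card (D v i) < card (N i)"
          using k(1) card_Diff1_less[OF less.prems(1)[OF k(1)] v(1)]
          by (intro bexI[of _ k]) (simp_all add: D_def del: card_Diff_insert card_Diff_singleton)
      qed
      moreover have "finite (D v i)" if "i \<in> I" for i using less.prems(1)[OF that] less.prems(1)[OF k(1)] by (simp add: D_def)
      ultimately obtain f where f: "inj_on f I" "\<forall>i\<in>I. f i \<in> D v i"
        using less.hyps[of "D v"] v(2) by blast
      have "D v i \<subseteq> N i" for i by (auto simp: D_def)
      then show ?thesis using f by blast
    next
      case False
      \<comment> \<open>A set violating the condition after the removal of \<open>v\<close> must
        contain \<open>k\<close>; \<open>X\<close> is that set without \<open>k\<close>, which turns
        the strict inequality into \<le>.\<close>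
      have bad: "\<exists>X. X \<subseteq> I - {k} \<and> card (\<Union> (N ` X) \<union> (N k - {v})) \<le> card X" if "v \<in> N k" for v
      proof -
        obtain X where X: "X \<subseteq> I" "card (\<Union> (D v ` X)) < card X" using False \<open>v \<in> N k\<close> not_le by blast
        have "k \<in> X"
        proof (rule ccontr)
          assume "k \<notin> X"
          then have "\<Union> (D v ` X) = \<Union> (N ` X)" by (auto simp: D_def)
          then show False using hall[OF X(1)] X(2) by simp
        qed
        then have "\<Union> (D v ` X) = \<Union> (N ` (X - {k})) \<union> (N k - {v})" by (auto simp: D_def)
        moreover have "card X = Suc (card (X - {k}))"
          using \<open>k \<in> X\<close> X(1) assms(1) by (metis card_Suc_Diff1 finite_subset)
        ultimately show ?thesis using X by (intro exI[of _ "X - {k}"]) auto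
      qed
      obtain X Y where X: "X \<subseteq> I - {k}" "card (\<Union> (N ` X) \<union> (N k - {x})) \<le> card X"
        and Y: "Y \<subseteq> I - {k}" "card (\<Union> (N ` Y) \<union> (N k - {y})) \<le> card Y"
        using bad[OF xy(1)] bad[OF xy(2)] by blast
      let ?U = "\<Union> (N ` X) \<union> (N k - {x})" and ?V = "\<Union> (N ` Y) \<union> (N k - {y})"
      have XY: "X \<subseteq> I" "Y \<subseteq> I" using X(1) Y(1) by auto
      have fin: "finite X" "finite Y" "finite ?U" "finite ?V"
        using finite_subset[OF _ assms(1)] XY fN less.prems(1)[OF k(1)] by blast+
      \<comment> \<open>As \<open>x \<noteq> y\<close>, the two sets together cover
        \<open>N k\<close>, so \<open>k\<close> counts as an additional index. Submodularity then
        yields \<open>card X + card Y + 1 \<le> card ?U + card ?V\<close>, against the choice of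
        \<open>X\<close> and \<open>Y\<close>.\<close>
      have "card (insert k (X \<union> Y)) \<le> card (?U \<union> ?V)"
      proof -
        have "?U \<union> ?V = \<Union> (N ` insert k (X \<union> Y))" using xy by auto
        moreover have "insert k (X \<union> Y) \<subseteq> I" using XY k(1) by blast
        ultimately show ?thesis using hall by metis
      qed
      moreover have "card (X \<inter> Y) \<le> card (?U \<inter> ?V)"
      proof -
        have "card (X \<inter> Y) \<le> card (\<Union> (N ` (X \<inter> Y)))" using X(1) by (intro hall) auto
        also have "\<dots> \<le> card (?U \<inter> ?V)" using fin by (intro card_mono) auto
        finally show ?thesis .
      qed
      moreover have "card (insert k (X \<union> Y)) = Suc (card (X \<union> Y))"
        using X(1) Y(1) fin(1,2) by (intro card_insert_disjoint) auto
      moreover have "card X + card Y = card (X \<union> Y) + card (X \<inter> Y)"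
        "card ?U + card ?V = card (?U \<union> ?V) + card (?U \<inter> ?V)"
        using fin by (intro card_Un_Int; simp)+
      ultimately have False using X(2) Y(2) by linarith
      then show ?thesis ..
    qed
  qed
qed

text \<open>Two copies of one singleton admit no pair with \<open>f i \<noteq> g i\<close>, so the
  induction starts at 2, where exchanging \<open>c\<close> and \<open>d\<close> resolves a
  clash.\<close>

lemma pairs_of_distinct_representatives_ge2:
  assumes "finite P" "finite Q" "card P \<ge> l" "card Q \<ge> l" "l \<ge> 2"
  shows "\<exists>f g. inj_on f {..<l} \<and> inj_on g {..<l} \<and> (\<forall>i<l. f i \<in> P \<and> g i \<in> Q \<and> f i \<noteq> g i)"
  using assms(5,1-4)
proof (induction l arbitrary: P Q rule: nat_induct_at_least)
  case base
  obtain a b where P: "a \<in> P" "b \<in> P" "a \<noteq> b"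
    using base by (metis card_le_Suc0_iff_eq not_less_eq_eq numeral_2_eq_2)
  obtain c d where Q: "c \<in> Q" "d \<in> Q" "c \<noteq> d"
    using base by (metis card_le_Suc0_iff_eq not_less_eq_eq numeral_2_eq_2)
  obtain c' d' where Q': "c' \<in> Q" "d' \<in> Q" "c' \<noteq> d'" "a \<noteq> c'" "b \<noteq> d'"
    using P(3) Q by metis
  show ?case
    using P Q' by (intro exI[of _ "\<lambda>i. if i = 0 then a else b"] exI[of _ "\<lambda>i. if i = 0 then c' else d'"])
      (auto simp: inj_on_def less_2_cases_iff)
next
  case (Suc l)
  obtain p where p: "p \<in> P" using Suc.prems by fastforce
  have "\<not> Q \<subseteq> {p}" using Suc.prems Suc.hyps card_mono[of "{p}" Q] by auto
  then obtain q where q: "q \<in> Q" "q \<noteq> p" by blast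
  obtain f g where fg: "inj_on f {..<l}" "inj_on g {..<l}"
      "\<forall>i<l. f i \<in> P - {p} \<and> g i \<in> Q - {q} \<and> f i \<noteq> g i"
  proof -
    have "l \<le> card (P - {p})" "l \<le> card (Q - {q})" using Suc.prems p q(1) by simp_all
    then show ?thesis using Suc.IH[of "P - {p}" "Q - {q}"] Suc.prems(1,2) that by blast
  qed
  then have "inj_on (f(l := p)) {..<Suc l}" "inj_on (g(l := q)) {..<Suc l}"
    by (auto simp: inj_on_def less_Suc_eq)
  moreover have "\<forall>i<Suc l. (f(l := p)) i \<in> P \<and> (g(l := q)) i \<in> Q \<and> (f(l := p)) i \<noteq> (g(l := q)) i"
    using fg(3) p q by (auto simp: less_Suc_eq)
  ultimately show ?case by blast
qed

text \<open>For \<open>l = 1\<close> two pairs are chosen and one is dropped.\<close>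

lemma pairs_of_distinct_representatives:
  assumes "finite P" "finite Q" "card P \<ge> max l 2" "card Q \<ge> max l 2"
  shows "\<exists>f g. inj_on f {..<l} \<and> inj_on g {..<l} \<and> (\<forall>i<l. f i \<in> P \<and> g i \<in> Q \<and> f i \<noteq> g i)"
proof -
  obtain f g where "inj_on f {..<max l 2}" "inj_on g {..<max l 2}"
    "\<forall>i<max l 2. f i \<in> P \<and> g i \<in> Q \<and> f i \<noteq> g i"
    using pairs_of_distinct_representatives_ge2[OF assms] by auto
  then show ?thesis by (intro exI[of _ f] exI[of _ g]) (auto intro: inj_on_subset)
qed

section \<open>Vertex separators\<close>

definition separates :: "'a pair_pre_digraph \<Rightarrow> 'a set \<Rightarrow> 'a set \<Rightarrow> 'a set \<Rightarrow> bool" where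
  "separates G T C D \<longleftrightarrow> C \<union> D = pverts G - T \<and> C \<inter> D = {} \<and> C \<noteq> {} \<and> D \<noteq> {} \<and>
     (\<forall>u\<in>C. \<forall>v\<in>D. (u, v) \<notin> parcs G)"

text \<open>\<open>C\<close> is the set reachable from \<open>u\<close>; conversely, reachability
  from \<open>C\<close> never leaves \<open>C\<close>. The remaining vertex set is assumed nonempty
  because the library counts the empty graph as not connected.\<close>

lemma not_connected_iff_separates:
  assumes "symmetric (with_proj G)" "pverts G - T \<noteq> {}"
  shows "\<not> Digraph_Component.connected (with_proj G \<restriction> (pverts G - T)) \<longleftrightarrow> (\<exists>C D. separates G T C D)"
proof -
  let ?V = "pverts G - T"
  define E where "E = {(u, v) \<in> parcs G. u \<in> ?V \<and> v \<in> ?V}"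
  have sym: "(v, u) \<in> parcs G" if "(u, v) \<in> parcs G" for u v
    using assms(1) that by (auto simp: symmetric_def dest: symD)
  have "arcs_ends (with_proj G \<restriction> ?V) = E"
    unfolding arcs_ends_conv E_def by force
  moreover have "E\<^sup>s = E" using sym by (auto simp: symcl_def E_def)
  ultimately have con: "Digraph_Component.connected (with_proj G \<restriction> ?V) \<longleftrightarrow>
      (\<forall>u\<in>?V. \<forall>v\<in>?V. (u, v) \<in> rtrancl_on ?V E)"
    using assms(2) by (simp add: connected_conv)
  show ?thesis unfolding con
  proof
    assume "\<not> (\<forall>u\<in>?V. \<forall>v\<in>?V. (u, v) \<in> rtrancl_on ?V E)"
    then obtain u v where uv: "u \<in> ?V" "v \<in> ?V" "(u, v) \<notin> rtrancl_on ?V E" by blast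
    let ?C = "{w \<in> ?V. (u, w) \<in> rtrancl_on ?V E}"
    have "(x, y) \<notin> parcs G" if x: "x \<in> ?C" and y: "y \<in> ?V - ?C" for x y
    proof
      assume "(x, y) \<in> parcs G"
      then have "(x, y) \<in> E" using x y by (simp add: E_def)
      then have "(u, y) \<in> rtrancl_on ?V E" using x y by (blast intro: rtrancl_on_into_rtrancl_on)
      then show False using y by blast
    qed
    moreover have "u \<in> ?C" using uv(1) by simp
    moreover have "v \<in> ?V - ?C" using uv by simp
    ultimately have "separates G T ?C (?V - ?C)" unfolding separates_def by blast
    then show "\<exists>C D. separates G T C D" by blast
  next
    assume "\<exists>C D. separates G T C D"
    then obtain C D where CD: "separates G T C D" by blast
    then obtain u v where uv: "u \<in> C" "v \<in> D" by (auto simp: separates_def)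
    have "w \<in> C" if "(u, w) \<in> rtrancl_on ?V E" for w
      using that
    proof (induction rule: rtrancl_on_induct)
      case (step y z)
      then show ?case using CD unfolding separates_def E_def by blast
    qed (use uv in simp)
    then show "\<not> (\<forall>u\<in>?V. \<forall>v\<in>?V. (u, v) \<in> rtrancl_on ?V E)"
      using uv CD unfolding separates_def by blast
  qed
qed

text \<open>The bound on the order rules out the clause about at most one remaining vertex, so the
  minimum is attained by a separator.\<close>

lemma vertex_connectivity_witness:
  assumes "symmetric (with_proj G)" "finite (pverts G)" "vertex_connectivity G + 1 < card (pverts G)"
  obtains S C D where "S \<subseteq> pverts G" "card S = vertex_connectivity G" "separates G S C D"
proof -
  let ?P = "\<lambda>k. \<exists>S. S \<subseteq> pverts G \<and> card S = k \<and>
     (\<not> Digraph_Component.connected (with_proj G \<restriction> (pverts G - S)) \<or> card (pverts G - S) \<le> 1)"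
  have "?P (card (pverts G))" by (intro exI[of _ "pverts G"]) simp
  then have "?P (vertex_connectivity G)" unfolding vertex_connectivity_def by (rule LeastI)
  then obtain S where S: "S \<subseteq> pverts G" "card S = vertex_connectivity G"
    "\<not> Digraph_Component.connected (with_proj G \<restriction> (pverts G - S)) \<or> card (pverts G - S) \<le> 1"
    by blast
  have "card (pverts G - S) > 1"
    using S(1,2) assms(2,3) by (simp add: card_Diff_subset finite_subset)
  moreover from this have "pverts G - S \<noteq> {}" by (metis card.empty not_less_zero)
  ultimately obtain C D where "separates G S C D"
    using S(3) not_connected_iff_separates[OF assms(1), of S] by auto
  then show ?thesis using S(1,2) by (rule that[rotated 2])
qed

lemma vertex_connectivity_le_separator:
  assumes "symmetric (with_proj G)" "S \<subseteq> pverts G" "separates G S C D"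
  shows "vertex_connectivity G \<le> card S"
  unfolding vertex_connectivity_def
proof (rule Least_le)
  have "pverts G - S \<noteq> {}" using assms(3) by (auto simp: separates_def)
  then show "\<exists>T. T \<subseteq> pverts G \<and> card T = card S \<and>
     (\<not> Digraph_Component.connected (with_proj G \<restriction> (pverts G - T)) \<or> card (pverts G - T) \<le> 1)"
    using assms not_connected_iff_separates by blast
qed

lemma vertex_connectivity_eqI:
  assumes "symmetric (with_proj G)" "finite (pverts G)" "k + 1 < card (pverts G)"
    and S: "S \<subseteq> pverts G" "card S = k" "separates G S A B"
    and no: "\<And>T C D. T \<subseteq> pverts G \<Longrightarrow> card T < k \<Longrightarrow> \<not> separates G T C D"
  shows "vertex_connectivity G = k"
proof -
  have le: "vertex_connectivity G \<le> k" using vertex_connectivity_le_separator[OF assms(1) S(1,3)] S(2) by simp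
  then have "vertex_connectivity G + 1 < card (pverts G)" using assms(3) by linarith
  then obtain T C D where "T \<subseteq> pverts G" "card T = vertex_connectivity G" "separates G T C D"
    by (rule vertex_connectivity_witness[OF assms(1,2)])
  then show ?thesis using no[of T C D] le by linarith
qed

section \<open>Minimum separators of dense graphs\<close>

lemma min_degree_le:
  assumes "pair_graph G" "v \<in> pverts G"
  shows "min_degree G \<le> card {u. (v, u) \<in> parcs G}"
proof -
  interpret pair_graph G by fact
  have "bij_betw snd (out_arcs (with_proj G) v) {u. (v, u) \<in> parcs G}"
    by (auto simp: bij_betw_def inj_on_def out_arcs_def image_iff)
  then have "out_degree (with_proj G) v = card {u. (v, u) \<in> parcs G}"
    unfolding out_degree_def by (rule bij_betw_same_card)
  then show ?thesis unfolding min_degree_def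
    using assms(2) pair_finite_verts by (metis Min_le finite_imageI imageI)
qed

text \<open>Subtracted terms of the two order bounds stand on the other side to avoid truncation;
  the 6 in \<open>n2\<close> is 4 plus twice the largest value 1 of the ceiling. \<open>conn\<close>
  is the minimality of \<open>S\<close>.\<close>

locale dense_separation =
  fixes G :: "'a pair_pre_digraph" and S A B :: "'a set" and k d l :: nat
  assumes graph: "pair_graph G"
    and sub: "S \<subseteq> pverts G" and card_S: "card S = k" and sep: "separates G S A B"
    and deg: "\<And>v. v \<in> pverts G \<Longrightarrow> d \<le> card {u. (v, u) \<in> parcs G}"
    and n_le: "card (pverts G) \<le> 2 * d" and l: "l \<ge> 1"
    and n1: "2 * k * l + k + 1 \<le> card (pverts G) + 2 * l"
    and n2: "6 * k + 8 * l \<le> card (pverts G) + 6"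
    and conn: "\<And>T C D. T \<subseteq> pverts G \<Longrightarrow> card T < k \<Longrightarrow> \<not> separates G T C D"
begin

section \<open>Missing edges on one side of the separator\<close>

definition adj :: "'a \<Rightarrow> 'a \<Rightarrow> bool" where "adj u v \<longleftrightarrow> (u, v) \<in> parcs G"
definition nbrs :: "'a \<Rightarrow> 'a set" where "nbrs v = {u. adj v u}"

lemma finite_verts: "finite (pverts G)"
  using graph by (simp add: pair_graph_def pair_digraph_def pair_fin_digraph_def pair_fin_digraph_axioms_def)

lemma symmetric: "symmetric (with_proj G)"
proof -
  interpret pair_graph G by (rule graph)
  show ?thesis by (rule pair_sym_arcs)
qed

lemma adj_sym: "adj u v \<Longrightarrow> adj v u"
proof -
  interpret pair_graph G by (rule graph)
  show "adj u v \<Longrightarrow> adj v u" unfolding adj_def by (rule arcs_symmetric)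
qed

lemma adj_irrefl: "\<not> adj v v"
proof -
  interpret pair_graph G by (rule graph)
  show ?thesis unfolding adj_def using no_loops' by blast
qed

lemma adj_verts: "adj u v \<Longrightarrow> u \<in> pverts G \<and> v \<in> pverts G"
proof -
  interpret pair_graph G by (rule graph)
  show "adj u v \<Longrightarrow> u \<in> pverts G \<and> v \<in> pverts G" unfolding adj_def by (blast dest: wellformed')
qed

text \<open>Facts about \<open>A\<close> are transferred to \<open>B\<close> by interpreting the
  locale with the sides exchanged, under the name \<open>sw\<close>.\<close>

lemma swap: "dense_separation G S B A k d l"
proof -
  have "separates G S B A" using sep adj_sym unfolding separates_def adj_def by blast
  then show ?thesis by (intro dense_separation.intro graph sub card_S deg n_le l n1 n2 conn)
qed

lemma sides: "pverts G = A \<union> B \<union> S" "A \<inter> B = {}" "A \<inter> S = {}" "B \<inter> S = {}"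
  "A \<noteq> {}" "B \<noteq> {}" "\<And>a b. a \<in> A \<Longrightarrow> b \<in> B \<Longrightarrow> \<not> adj a b"
  using sep sub unfolding separates_def adj_def by auto

lemma finite_sides: "finite A" "finite B" "finite S"
  using finite_verts sides(1) by auto

lemma card_sides: "card A + card B + k = card (pverts G)"
  unfolding sides(1) using finite_sides sides(2-4) card_S
  by (simp add: card_Un_disjoint Int_Un_distrib2)

lemma deg_nbrs: "v \<in> pverts G \<Longrightarrow> d \<le> card (nbrs v)"
  using deg unfolding nbrs_def adj_def by blast

lemma finite_nbrs: "finite (nbrs v)"
  by (rule finite_subset[OF _ finite_verts]) (use adj_verts in \<open>auto simp: nbrs_def\<close>)

lemma d_ge: "3 * k + 4 * l \<le> d + 3"
  using n2 n_le by linarith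

lemma nbrs_A: "a \<in> A \<Longrightarrow> nbrs a \<subseteq> A \<union> S - {a}"
  using adj_verts sides(1,7) adj_irrefl unfolding nbrs_def by blast

text \<open>All neighbours of a vertex of \<open>A\<close> lie in \<open>A \<union> S\<close>
  without that vertex. This makes the subtraction in \<open>excess\<close> exact.\<close>

lemma d_le: "d + 1 \<le> card A + k"
proof -
  obtain a where a: "a \<in> A" using sides(5) by blast
  have "d \<le> card (nbrs a)" using deg_nbrs a sides(1) by blast
  also have "\<dots> \<le> card (A \<union> S - {a})" using nbrs_A[OF a] finite_sides by (intro card_mono) auto
  also have "\<dots> = card A + k - 1"
    using a finite_sides sides(3) card_S by (simp add: card_Un_disjoint)
  finally show ?thesis using l d_ge a finite_sides(1) card_gt_0_iff[of A] by auto
qed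

text \<open>The \<alpha> of the outline: of \<open>card A + k - 1\<close> possible neighbours, a
  vertex of \<open>A\<close> has at least \<open>d\<close>. With the sides exchanged it is
  \<beta>.\<close>

definition excess :: nat where "excess = card A + k - 1 - d"

lemma card_A: "card A + k = excess + d + 1"
  using d_le unfolding excess_def by simp

lemma nonnbrs_A:
  assumes "a \<in> A"
  shows "card {b \<in> A \<union> S. \<not> adj a b} \<le> excess + 1"
proof -
  have "{b \<in> A \<union> S. \<not> adj a b} = (A \<union> S) - nbrs a" by (auto simp: nbrs_def)
  also have "card \<dots> = card (A \<union> S) - card (nbrs a)"
    using nbrs_A[OF assms] finite_nbrs by (intro card_Diff_subset) auto
  also have "\<dots> \<le> card (A \<union> S) - d" using deg_nbrs[of a] assms sides(1) by (intro diff_le_mono2) auto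
  also have "card (A \<union> S) = card A + k" using finite_sides sides(3) card_S by (simp add: card_Un_disjoint)
  finally show ?thesis using card_A by simp
qed

text \<open>Double counting of non-adjacent pairs: each of these vertices misses at least
  \<open>card A - c\<close> vertices of \<open>A\<close>, and each vertex of \<open>A\<close> misses
  at most \<open>excess\<close> of them. With \<open>excess + 1\<close> such vertices this
  contradicts the assumption.\<close>

lemma card_few_nbrs:
  assumes c: "(excess + 1) * c < card A"
  shows "card {s \<in> S. card (nbrs s \<inter> A) \<le> c} \<le> excess"
proof (rule ccontr)
  let ?X = "{s \<in> S. card (nbrs s \<inter> A) \<le> c}"
  assume "\<not> ?thesis"
  then have X: "excess + 1 \<le> card ?X" by simp
  have fX: "finite ?X" using finite_sides by simp
  have "(card A - c) * (excess + 1) \<le> (card A - c) * card ?X" using X by (rule mult_le_mono2)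
  also have "\<dots> = (\<Sum>x\<in>?X. card A - c)" by simp
  also have "\<dots> \<le> (\<Sum>x\<in>?X. card {a \<in> A. \<not> adj x a})"
  proof (rule sum_mono)
    fix x assume x: "x \<in> ?X"
    have "{a \<in> A. \<not> adj x a} = A - nbrs x \<inter> A" by (auto simp: nbrs_def)
    then have "card {a \<in> A. \<not> adj x a} = card A - card (nbrs x \<inter> A)"
      using finite_sides(1) by (simp add: card_Diff_subset)
    then show "card A - c \<le> card {a \<in> A. \<not> adj x a}" using x diff_le_mono2[of "card (nbrs x \<inter> A)" c "card A"] by simp
  qed
  also have "\<dots> = (\<Sum>a\<in>A. card {x \<in> ?X. \<not> adj x a})"
    by (rule sum_multicount_gen) (use fX finite_sides in auto)
  also have "\<dots> \<le> (\<Sum>a\<in>A. excess)"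
  proof (rule sum_mono)
    fix a assume a: "a \<in> A"
    \<comment> \<open>\<open>a\<close> is itself one of its \<open>excess + 1\<close>
      non-neighbours, which leaves \<open>excess\<close> for \<open>S\<close>.\<close>
    have sub: "insert a {x \<in> ?X. \<not> adj x a} \<subseteq> {b \<in> A \<union> S. \<not> adj a b}"
      using a adj_irrefl adj_sym by blast
    have "finite {b \<in> A \<union> S. \<not> adj a b}" using finite_sides by simp
    from order_trans[OF card_mono[OF this sub] nonnbrs_A[OF a]]
    have "card (insert a {x \<in> ?X. \<not> adj x a}) \<le> excess + 1" .
    moreover have "card (insert a {x \<in> ?X. \<not> adj x a}) = Suc (card {x \<in> ?X. \<not> adj x a})"
      by (rule card_insert_disjoint) (use finite_sides(3) a sides(3) in auto)
    ultimately show "card {x \<in> ?X. \<not> adj x a} \<le> excess" by linarith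
  qed
  also have "\<dots> = card A * excess" by simp
  finally have "card A * (excess + 1) \<le> card A * excess + c * (excess + 1)"
    by (simp add: diff_mult_distrib)
  then show False using c by (simp add: algebra_simps)
qed

text \<open>If \<open>X\<close> had a neighbourhood \<open>N\<close> in \<open>A\<close> with fewer
  than \<open>card X\<close> vertices, then \<open>(S - X) \<union> N\<close> would separate
  \<open>A - N\<close> from \<open>B \<union> X\<close> and be smaller than
  \<open>S\<close>.\<close>

lemma matching_A: "\<exists>f. inj_on f S \<and> (\<forall>s\<in>S. f s \<in> A \<and> adj s (f s))"
proof -
  have "\<exists>f. inj_on f S \<and> (\<forall>s\<in>S. f s \<in> nbrs s \<inter> A)"
  proof (rule hall_matching[OF finite_sides(3)])
    show "card X \<le> card (\<Union>s\<in>X. nbrs s \<inter> A)" if X: "X \<subseteq> S" for X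
    proof (rule ccontr)
      define N where "N = (\<Union>s\<in>X. nbrs s \<inter> A)"
      have N: "u \<in> N" if "u \<in> A" "v \<in> X" "adj v u" for u v
        using that by (auto simp: N_def nbrs_def)
      have NA: "N \<subseteq> A" by (auto simp: N_def)
      define T where "T = (S - X) \<union> N"
      assume "\<not> ?thesis"
      then have less: "card N < card X" by (simp add: N_def)
      have fX: "finite X" using X finite_sides(3) finite_subset by blast
      have "card T \<le> (k - card X) + card N"
        using card_Un_le[of "S - X" N] X fX card_S by (simp add: T_def card_Diff_subset)
      moreover have Xk: "card X \<le> k" using card_mono[OF finite_sides(3) X] card_S by simp
      ultimately have T: "card T < k" using less by linarith
      \<comment> \<open>The degree bound makes \<open>A\<close> larger than \<open>k\<close>, so
        \<open>A - N\<close> is nonempty.\<close>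
      have "card N < card A" using less Xk d_le d_ge l by linarith
      then have "A - N \<noteq> {}" using NA by auto
      moreover have "B \<union> X \<noteq> {}" using sides(6) by blast
      moreover have "(A - N) \<union> (B \<union> X) = pverts G - T" "(A - N) \<inter> (B \<union> X) = {}"
        unfolding sides(1) T_def using sides(2-4) X NA by blast+
      moreover have "\<forall>u\<in>A - N. \<forall>v\<in>B \<union> X. (u, v) \<notin> parcs G"
        using sides(7) N adj_sym unfolding adj_def by blast
      ultimately have "separates G T (A - N) (B \<union> X)" unfolding separates_def by blast
      moreover have "T \<subseteq> pverts G" unfolding sides(1) T_def using NA by blast
      ultimately show False using conn[OF _ T] by blast
    qed
  qed (use finite_sides in simp)
  then show ?thesis by (simp add: nbrs_def Int_def conj_commute)
qed

end

section \<open>Separator vertices with many neighbours on both sides\<close>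

text \<open>Here the first order bound enters. With \<open>k = e + 2 + r\<close> one has
  \<open>c = d - 1 - r\<close>, and doubling gives
  \<open>2 * c \<ge> 2 * (e + 1) * l + 2 * r * (l - 1) + k - 1\<close>, where
  \<open>k \<ge> 2\<close>.\<close>

lemma crossing_bound:
  fixes e k l n d c :: nat
  assumes "e + 2 \<le> k" "2 * k * l + k + 1 \<le> n + 2 * l" "n \<le> 2 * d" "c + k = e + d + 1" "l \<ge> 1"
  shows "(e + 1) * l < c"
proof -
  obtain r where r: "k = e + 2 + r" using assms(1) le_Suc_ex by blast
  have "2 * k * l = 2 * ((e + 1) * l) + 2 * l + 2 * (r * l)"
    unfolding r by (simp add: algebra_simps)
  moreover have "r \<le> r * l" using assms(5) by simp
  moreover define x where "x = (e + 1) * l"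
  moreover define y where "y = r * l"
  moreover define z where "z = 2 * k * l"
  ultimately show ?thesis using assms(2-4) r unfolding x_def[symmetric] y_def[symmetric] z_def[symmetric]
    by linarith
qed

context dense_separation
begin

text \<open>Adding \<open>card_A\<close> for both sides and subtracting \<open>card_sides\<close>
  gives \<open>k = \<alpha> + \<beta> + 2 + (2 * d - n)\<close> for a graph of order
  \<open>n \<le> 2 * d\<close>.\<close>

lemma excess_sum: "k \<ge> 2" "excess + dense_separation.excess B k d + 2 \<le> k"
proof -
  interpret sw: dense_separation G S B A k d l by (rule swap)
  show "k \<ge> 2" "excess + sw.excess + 2 \<le> k"
    using card_A sw.card_A card_sides n_le by linarith+
qed

lemma excess_le: "excess + 2 \<le> k"
  using excess_sum(2) by linarith

lemma card_A_ge: "card A + 2 \<ge> excess + 2 * k + 4 * l"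
  using card_A d_ge by linarith

text \<open>A vertex above the threshold keeps at least \<open>max l 2\<close> neighbours after
  losing a matching edge, as \<open>pairs_of_distinct_representatives\<close> requires.\<close>

lemma many_nbrs_A: "card {s \<in> S. card (nbrs s \<inter> A) \<le> max l 2} \<le> excess"
proof (rule card_few_nbrs)
  have "(excess + 1) * l < card A"
    by (rule crossing_bound[OF excess_le n1 n_le card_A l])
  moreover have "(excess + 1) * 2 < card A" using card_A_ge excess_le l by (simp add: algebra_simps)
  ultimately show "(excess + 1) * max l 2 < card A" by (cases "l \<le> 2") (simp_all add: max_def)
qed

lemma nonnbrs_side:
  assumes "a \<in> A"
  shows "card {b \<in> A. \<not> adj a b} \<le> excess + 1"
proof (rule order_trans[OF card_mono nonnbrs_A[OF assms]])
  show "finite {b \<in> A \<union> S. \<not> adj a b}" using finite_sides by simp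
qed blast

text \<open>At most \<alpha> + \<beta> \<le> k - 2 vertices of \<open>S\<close> have few neighbours
  on some side.\<close>

lemma two_crossing_vertices:
  obtains s t where "s \<in> S" "t \<in> S" "s \<noteq> t"
    "\<forall>x\<in>{s, t}. max l 2 < card (nbrs x \<inter> A) \<and> max l 2 < card (nbrs x \<inter> B)"
proof -
  interpret sw: dense_separation G S B A k d l by (rule swap)
  define X where "X = {s \<in> S. card (nbrs s \<inter> A) \<le> max l 2}"
  define Y where "Y = {s \<in> S. card (nbrs s \<inter> B) \<le> max l 2}"
  have "card X \<le> excess" "card Y \<le> sw.excess"
    using many_nbrs_A sw.many_nbrs_A unfolding X_def Y_def by simp_all
  then have "card (X \<union> Y) \<le> excess + sw.excess"
    using card_Un_le[of X Y] by linarith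
  moreover have "card S - card (X \<union> Y) \<le> card (S - (X \<union> Y))"
    by (rule diff_card_le_card_Diff) (use finite_sides(3) in \<open>simp add: X_def Y_def\<close>)
  ultimately have "\<not> card (S - (X \<union> Y)) \<le> Suc 0" using excess_sum(2) card_S by linarith
  moreover have "finite (S - (X \<union> Y))" using finite_sides(3) by simp
  ultimately obtain s t where st: "s \<in> S - (X \<union> Y)" "t \<in> S - (X \<union> Y)" "s \<noteq> t"
    using card_le_Suc0_iff_eq by blast
  have *: "max l 2 < card (nbrs x \<inter> A) \<and> max l 2 < card (nbrs x \<inter> B)" if "x \<in> S - (X \<union> Y)" for x
    using that unfolding X_def Y_def by (simp add: not_le)
  show ?thesis
    by (rule that[of s t]) (use st * in blast)+
qed

text \<open>
  If the deleted edges avoid the matchings \<open>f\<close> and \<open>g\<close>, each \<open>s \<in> S\<close> keeps a path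
  \<open>f s, s, g s\<close> from \<open>A\<close> to \<open>B\<close>. These \<open>k\<close> paths are disjoint, so fewer than \<open>k\<close> vertices
  cannot destroy all of them.
\<close>

lemma vertex_connectivity_del_edges:
  assumes f: "inj_on f S" "\<And>s. s \<in> S \<Longrightarrow> f s \<in> A \<and> adj s (f s) \<and> {s, f s} \<notin> F"
    and g: "inj_on g S" "\<And>s. s \<in> S \<Longrightarrow> g s \<in> B \<and> adj s (g s) \<and> {s, g s} \<notin> F"
    and F: "\<And>v. finite {u. {v, u} \<in> F} \<and> card {u. {v, u} \<in> F} \<le> 2 * l"
  shows "vertex_connectivity (del_edges G F) = k"
proof (rule vertex_connectivity_eqI)
  let ?G = "del_edges G F"
  interpret sw: dense_separation G S B A k d l by (rule swap)
  show "symmetric (with_proj ?G)"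
    using symmetric by (auto simp: symmetric_def del_edges_def sym_def insert_commute)
  show "finite (pverts ?G)" using finite_verts by (simp add: del_edges_def)
  show "k + 1 < card (pverts ?G)" using card_sides card_A_ge l excess_le by (simp add: del_edges_def)
  show "S \<subseteq> pverts ?G" using sub by (simp add: del_edges_def)
  show "card S = k" by (rule card_S)
  show "separates ?G S A B" using sep by (auto simp: separates_def del_edges_def)
  fix T C D assume T: "T \<subseteq> pverts ?G" "card T < k"
  have fT: "finite T" using T(1) finite_verts finite_subset by (auto simp: del_edges_def)
  have sep_adj: "{u, v} \<in> F" if "separates ?G T C D" "u \<in> C" "v \<in> D" "adj u v" for C D u v
    using that by (auto simp: separates_def del_edges_def adj_def)
  have sep_sym: "separates ?G T D C" if "separates ?G T C D" for C D
  proof -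
    have "(v, u) \<notin> parcs ?G" if "(u, v) \<notin> parcs ?G" for u v
      using that adj_sym[of v u] by (auto simp: del_edges_def adj_def insert_commute)
    then show ?thesis using that unfolding separates_def by blast
  qed
  \<comment> \<open>A vertex of \<open>A'\<close> in \<open>C\<close> misses at most
    \<open>e\<close> others and loses at most \<open>2 * l\<close> edges, so \<open>D\<close>
    contains at most \<open>e + 2 * l\<close> vertices of \<open>A'\<close>; likewise
    \<open>C\<close>. Together with \<open>T\<close> these are too few to cover
    \<open>A'\<close>.\<close>
  have one_side: "A' \<inter> C = {} \<or> A' \<inter> D = {}"
    if CD: "separates ?G T C D" and A': "finite A'" "\<And>a. a \<in> A' \<Longrightarrow> a \<in> pverts G \<and> card {b \<in> A'. \<not> adj a b} \<le> e + 1"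
      "k + 2 * e + 4 * l \<le> card A'" for C D A' e
  proof (rule ccontr)
    assume "\<not> ?thesis"
    then obtain a b where ab: "a \<in> A' \<inter> C" "b \<in> A' \<inter> D" by blast
    have bound: "card (A' \<inter> D) \<le> e + 2 * l" if "separates ?G T C D" "a \<in> A' \<inter> C" for C D a
    proof -
      have fin: "finite {b \<in> A'. \<not> adj a b}" using A'(1) by simp
      have few: "card {b \<in> A'. \<not> adj a b} \<le> e + 1" using A'(2) that(2) by blast
      have aD: "a \<notin> D" using that by (auto simp: separates_def)
      have "insert a (A' \<inter> D) \<subseteq> {b \<in> A'. \<not> adj a b} \<union> {b. {a, b} \<in> F}"
        using sep_adj[OF that(1)] that(2) adj_irrefl by auto
      then have "card (insert a (A' \<inter> D)) \<le> card ({b \<in> A'. \<not> adj a b} \<union> {b. {a, b} \<in> F})"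
        using F fin by (intro card_mono) auto
      also have "\<dots> \<le> (e + 1) + 2 * l"
        using card_Un_le[of "{b \<in> A'. \<not> adj a b}" "{b. {a, b} \<in> F}"] few F[of a] by linarith
      also have "card (insert a (A' \<inter> D)) = card (A' \<inter> D) + 1"
        using aD A'(1) by simp
      finally show ?thesis by simp
    qed
    have "A' \<subseteq> T \<union> (A' \<inter> C) \<union> (A' \<inter> D)"
      using CD A'(2) by (auto simp: separates_def del_edges_def)
    then have "card A' \<le> card (T \<union> (A' \<inter> C) \<union> (A' \<inter> D))"
      using fT A'(1) by (intro card_mono) auto
    also have "\<dots> \<le> card T + card (A' \<inter> C) + card (A' \<inter> D)"
      by (rule order_trans[OF card_Un_le add_right_mono[OF card_Un_le]])
    finally show False
      using bound[OF CD ab(1)] bound[OF sep_sym[OF CD] ab(2)] T(2) A'(3) by linarith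
  qed
  have one_side_A: "A \<inter> C = {} \<or> A \<inter> D = {}" if "separates ?G T C D" for C D
  proof (rule one_side[OF that finite_sides(1)])
    show "a \<in> pverts G \<and> card {b \<in> A. \<not> adj a b} \<le> excess + 1" if "a \<in> A" for a
      using that sides(1) nonnbrs_side[OF that] by blast
    show "k + 2 * excess + 4 * l \<le> card A" using card_A_ge excess_le by linarith
  qed
  have one_side_B: "B \<inter> C = {} \<or> B \<inter> D = {}" if "separates ?G T C D" for C D
  proof (rule one_side[OF that finite_sides(2)])
    show "b \<in> pverts G \<and> card {c \<in> B. \<not> adj b c} \<le> sw.excess + 1" if "b \<in> B" for b
      using that sides(1) sw.nonnbrs_side[OF that] by blast
    show "k + 2 * sw.excess + 4 * l \<le> card B" using sw.card_A_ge sw.excess_le by linarith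
  qed
  obtain s where s: "s \<in> S" "s \<notin> T" "f s \<notin> T" "g s \<notin> T"
  proof (rule ccontr)
    assume "\<not> thesis"
    then have "\<forall>s\<in>S. \<exists>x\<in>T. x \<in> {s, f s, g s}" using that by blast
    then obtain h where h: "\<And>s. s \<in> S \<Longrightarrow> h s \<in> T \<and> h s \<in> {s, f s, g s}" by metis
    have "inj_on h S"
    proof (rule inj_onI)
      fix x y assume xy: "x \<in> S" "y \<in> S" "h x = h y"
      have place: "h z \<in> S \<and> h z = z \<or> h z \<in> A \<and> h z = f z \<or> h z \<in> B \<and> h z = g z" if "z \<in> S" for z
        using h[OF that] f(2)[OF that] g(2)[OF that] that by auto
      have "x = y \<or> f x = f y \<or> g x = g y"
        using place[OF xy(1)] place[OF xy(2)] xy(3) sides(2-4) by (metis disjoint_iff)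
      then show "x = y" using inj_onD[OF f(1) _ xy(1,2)] inj_onD[OF g(1) _ xy(1,2)] by blast
    qed
    then have "card S \<le> card T" using h fT by (intro card_inj_on_le) auto
    then show False using T(2) card_S by simp
  qed
  \<comment> \<open>The path through \<open>s\<close> and the density of both sides keep
    \<open>A\<close> and \<open>B\<close> out of \<open>D\<close>, so
    \<open>D \<subseteq> S\<close>. A vertex of \<open>D\<close> then has fewer than
    \<open>2 * l + 2 * k\<close> neighbours, along deleted edges, in \<open>T\<close> or in
    \<open>S\<close>, which is less than \<open>d\<close>.\<close>
  have no: False if CD: "separates ?G T C D" and sC: "s \<in> C" for C D
  proof -
    have V: "C \<union> D = pverts G - T" "C \<inter> D = {}" "D \<noteq> {}"
      using CD by (auto simp: separates_def del_edges_def)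
    have "f s \<in> C \<union> D" "g s \<in> C \<union> D" unfolding V(1) sides(1) using s f(2) g(2) by blast+
    then have "f s \<in> C" "g s \<in> C"
      using sep_adj[OF CD sC] f(2)[OF s(1)] g(2)[OF s(1)] by blast+
    then have "A \<inter> D = {}" "B \<inter> D = {}"
      using one_side_A[OF CD] one_side_B[OF CD] f(2)[OF s(1)] g(2)[OF s(1)] by auto
    then have DS: "D \<subseteq> S" using V(1) sides(1) by blast
    obtain x where x: "x \<in> D" using V(3) by blast
    have "nbrs x \<subseteq> {u. {x, u} \<in> F} \<union> T \<union> (S - {x})"
    proof
      fix u assume "u \<in> nbrs x"
      then have u: "adj x u" by (simp add: nbrs_def)
      then show "u \<in> {u. {x, u} \<in> F} \<union> T \<union> (S - {x})"
        using sep_adj[OF sep_sym[OF CD] x] V(1) DS adj_verts[OF u] adj_irrefl by blast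
    qed
    then have "card (nbrs x) \<le> card ({u. {x, u} \<in> F} \<union> T \<union> (S - {x}))"
      using F fT finite_sides by (intro card_mono) auto
    also have "\<dots> \<le> card {u. {x, u} \<in> F} + card T + card (S - {x})"
      by (rule order_trans[OF card_Un_le add_right_mono[OF card_Un_le]])
    also have "\<dots> < 2 * l + k + k"
      using F[of x] T(2) card_Diff1_le[of S x] card_S by simp
    finally have "card (nbrs x) < 2 * l + k + k" .
    moreover have "d \<le> card (nbrs x)" using deg_nbrs x DS sub by blast
    ultimately show False using d_ge l excess_sum(1) by linarith
  qed
  show "\<not> separates ?G T C D"
  proof
    assume CD: "separates ?G T C D"
    then have "s \<in> C \<or> s \<in> D" using s sub by (auto simp: separates_def del_edges_def)
    then show False using no CD sep_sym by blast
  qed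
qed

section \<open>Cycles that avoid the matchings\<close>

text \<open>\<open>R\<close> is adjacency without the matching edges \<open>M\<close>. Each of these
  meets \<open>S\<close>, so nothing is lost inside the sides, and a vertex of \<open>S\<close>
  loses at most one edge to each side.\<close>

lemma hamiltonian_cycles_avoiding_matchings:
  assumes f: "inj_on f S" "\<forall>s\<in>S. f s \<in> A" and g: "inj_on g S" "\<forall>s\<in>S. g s \<in> B"
  shows "\<exists>vs. (\<forall>i<l. distinct (vs i) \<and> set (vs i) = pverts G
      \<and> successively adj (vs i @ [hd (vs i)]) \<and> 3 \<le> length (vs i)
      \<and> (\<forall>s\<in>S. {s, f s} \<notin> walk_edges (closed_walk (vs i)) \<and> {s, g s} \<notin> walk_edges (closed_walk (vs i))))
    \<and> disjoint_family_on (\<lambda>i. walk_edges (closed_walk (vs i))) {..<l}"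
proof -
  interpret sw: dense_separation G S B A k d l by (rule swap)
  define M where "M = (\<lambda>s. {s, f s}) ` S \<union> (\<lambda>s. {s, g s}) ` S"
  define R where "R u v \<longleftrightarrow> adj u v \<and> {u, v} \<notin> M" for u v
  obtain s t where st: "s \<in> S" "t \<in> S" "s \<noteq> t" and cross:
    "\<forall>x\<in>{s, t}. max l 2 < card (nbrs x \<inter> A) \<and> max l 2 < card (nbrs x \<inter> B)"
    by (rule two_crossing_vertices)
  define Z where "Z = S - {s, t}"
  have symR: "symp R"
  proof (rule sympI)
    fix u v assume "R u v"
    then show "R v u" using adj_sym unfolding R_def insert_commute[of v u] by blast
  qed
  have irrR: "\<not> R x x" for x using adj_irrefl by (simp add: R_def)
  have finZ: "finite Z" using finite_sides(3) by (simp add: Z_def)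
  have card_Z: "card Z + 2 = k"
    using st finite_sides(3) card_S excess_sum(1) card_Diff_subset[of "{s, t}" S] unfolding Z_def by simp
  have dis: "x \<notin> B" "x \<notin> S" if "x \<in> A" for x using that sides(2,3) by blast+
  have dis': "x \<notin> S" if "x \<in> B" for x using that sides(4) by blast
  have M_cases: "\<exists>s\<in>S. (u = s \<and> v = f s) \<or> (u = f s \<and> v = s) \<or> (u = s \<and> v = g s) \<or> (u = g s \<and> v = s)"
    if "{u, v} \<in> M" for u v
    using that unfolding M_def image_def Un_iff mem_Collect_eq doubleton_eq_iff by blast
  have fg: "f s \<in> A" "f s \<notin> B" "f s \<notin> S" "g s \<in> B" "g s \<notin> A" "g s \<notin> S" if "s \<in> S" for s
    using bspec[OF f(2) that] bspec[OF g(2) that] dis[of "f s"] dis[of "g s"] dis'[of "g s"] by blast+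
  have M_A: "v = f u" if "{u, v} \<in> M" "u \<in> S" "v \<in> A" for u v
    using M_cases[OF that(1)] that(2,3) fg by (elim bexE disjE conjE) (simp_all add: dis)
  have M_B: "v = g u" if "{u, v} \<in> M" "u \<in> S" "v \<in> B" for u v
    using M_cases[OF that(1)] that(2,3) fg by (elim bexE disjE conjE) (simp_all add: dis')
  have M_S: "u \<in> S \<or> v \<in> S" if "{u, v} \<in> M" for u v
    using M_cases[OF that] by blast
  have R_side: "card (nbrs u \<inter> A) \<le> card {a \<in> A. R u a} + 1" "card (nbrs u \<inter> B) \<le> card {b \<in> B. R u b} + 1"
    if "u \<in> S" for u
  proof -
    have "nbrs u \<inter> A \<subseteq> insert (f u) {a \<in> A. R u a}" "nbrs u \<inter> B \<subseteq> insert (g u) {b \<in> B. R u b}"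
      using M_A M_B that by (auto simp: nbrs_def R_def)
    then have "card (nbrs u \<inter> A) \<le> card (insert (f u) {a \<in> A. R u a})"
      "card (nbrs u \<inter> B) \<le> card (insert (g u) {b \<in> B. R u b})"
      using finite_sides by (auto intro!: card_mono)
    then show "card (nbrs u \<inter> A) \<le> card {a \<in> A. R u a} + 1" "card (nbrs u \<inter> B) \<le> card {b \<in> B. R u b} + 1"
      using finite_sides by (simp_all add: card_insert_if split: if_splits)
  qed
  have "\<exists>p q. inj_on p {..<l} \<and> inj_on q {..<l} \<and> (\<forall>i<l. p i \<in> {a \<in> A. R s a} \<and> q i \<in> {a \<in> A. R t a} \<and> p i \<noteq> q i)"
    by (rule pairs_of_distinct_representatives)
      (use cross R_side(1)[OF st(1)] R_side(1)[OF st(2)] finite_sides in auto)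
  then obtain p q where pq: "inj_on p {..<l}" "inj_on q {..<l}"
    "\<And>i. i < l \<Longrightarrow> p i \<in> A \<and> q i \<in> A \<and> p i \<noteq> q i \<and> R s (p i) \<and> R t (q i)" by auto
  have "\<exists>p q. inj_on p {..<l} \<and> inj_on q {..<l} \<and> (\<forall>i<l. p i \<in> {b \<in> B. R s b} \<and> q i \<in> {b \<in> B. R t b} \<and> p i \<noteq> q i)"
    by (rule pairs_of_distinct_representatives)
      (use cross R_side(2)[OF st(1)] R_side(2)[OF st(2)] finite_sides in auto)
  then obtain p' q' where pq': "inj_on p' {..<l}" "inj_on q' {..<l}"
    "\<And>i. i < l \<Longrightarrow> p' i \<in> B \<and> q' i \<in> B \<and> p' i \<noteq> q' i \<and> R s (p' i) \<and> R t (q' i)" by auto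
  have fewA: "card {b \<in> A. \<not> R a b} \<le> excess + 1" if "a \<in> A" for a
  proof -
    have "{b \<in> A. \<not> R a b} = {b \<in> A. \<not> adj a b}"
      using M_S that sides(3) by (auto simp: R_def)
    then show ?thesis using nonnbrs_side[OF that] by simp
  qed
  have fewB: "card {c \<in> B. \<not> R b c} \<le> sw.excess + 1" if "b \<in> B" for b
  proof -
    have "{c \<in> B. \<not> R b c} = {c \<in> B. \<not> adj b c}"
      using M_S that sides(4) by (auto simp: R_def)
    then show ?thesis using sw.nonnbrs_side[OF that] by simp
  qed
  have many: "2 * card Z + 3 + 2 * l \<le> card {a \<in> A. R z a} + card {b \<in> B. R z b} + 2" if z: "z \<in> Z" for z
  proof -
    have zS: "z \<in> S" using z by (simp add: Z_def)
    have "nbrs z \<subseteq> (nbrs z \<inter> A) \<union> (nbrs z \<inter> B) \<union> (S - {z})"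
      using adj_verts adj_irrefl sides(1) by (auto simp: nbrs_def)
    then have "card (nbrs z) \<le> card ((nbrs z \<inter> A) \<union> (nbrs z \<inter> B) \<union> (S - {z}))"
      using finite_sides by (intro card_mono) auto
    also have "\<dots> \<le> card (nbrs z \<inter> A) + card (nbrs z \<inter> B) + card (S - {z})"
      by (rule order_trans[OF card_Un_le add_right_mono[OF card_Un_le]])
    also have "card (S - {z}) = k - 1" using zS card_S finite_sides(3) by simp
    finally have "d \<le> card (nbrs z \<inter> A) + card (nbrs z \<inter> B) + (k - 1)"
      using deg_nbrs[of z] zS sub by auto
    \<comment> \<open>Without the neighbours in \<open>S\<close> and two matching edges at least
      \<open>2 * k + 4 * l - 4\<close> remain, where \<open>2 * k + 2 * l - 3\<close> are
      required.\<close>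
    then show ?thesis using R_side[OF zS] d_ge card_Z l by linarith
  qed
  have bigA: "card A + 3 > card Z + 2 * (excess + 1) + 4 * l"
    using card_A_ge excess_le card_Z by (simp add: algebra_simps)
  have bigB: "card B + 3 > card Z + 2 * (sw.excess + 1) + 4 * l"
    using sw.card_A_ge sw.excess_le card_Z by (simp add: algebra_simps)
  have dj: "A \<inter> Z = {}" "B \<inter> Z = {}" "s \<notin> A \<union> B \<union> Z" "t \<notin> A \<union> B \<union> Z" "{s, t} \<union> A \<union> B \<union> Z = pverts G"
    using sides st by (auto simp: Z_def)
  have "\<exists>vs. (\<forall>i<l. distinct (vs i) \<and> set (vs i) = {s, t} \<union> A \<union> B \<union> Z
      \<and> successively R (vs i @ [hd (vs i)]) \<and> 3 \<le> length (vs i))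
    \<and> disjoint_family_on (\<lambda>i. walk_edges (closed_walk (vs i))) {..<l}"
    by (rule edge_disjoint_closed_walks[OF symR irrR finite_sides(1,2) finZ sides(2) dj(1,2) st(3) dj(3,4)
          fewA fewB bigA bigB many pq pq'])
  then obtain vs where vs: "\<And>i. i < l \<Longrightarrow> distinct (vs i) \<and> set (vs i) = pverts G
      \<and> successively R (vs i @ [hd (vs i)]) \<and> 3 \<le> length (vs i)"
    and dis: "disjoint_family_on (\<lambda>i. walk_edges (closed_walk (vs i))) {..<l}"
    unfolding dj(5) by blast
  have "successively adj (vs i @ [hd (vs i)])" if "i < l" for i
    by (rule successively_mono[of R]) (use vs[OF that] in \<open>auto simp: R_def\<close>)
  moreover have "{u, f u} \<notin> walk_edges (closed_walk (vs i)) \<and> {u, g u} \<notin> walk_edges (closed_walk (vs i))"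
    if "i < l" "u \<in> S" for i u
  proof -
    have "\<not> R u (f u)" "\<not> R u (g u)" using that(2) by (auto simp: R_def M_def)
    then show ?thesis using closed_walk_edge[OF symR] vs[OF that(1)] by blast
  qed
  ultimately show ?thesis using vs dis by blast
qed

text \<open>The matchings are fixed first and the cycles avoid them. The cycles remove at most
  \<open>2 * l\<close> edges at each vertex, so \<open>vertex_connectivity_del_edges\<close>
  applies.\<close>

lemma hamiltonian_cycles_preserving_connectivity:
  "\<exists>H :: nat \<Rightarrow> ('a \<times> 'a) awalk.
     (\<forall>i\<in>{1..l}. hamiltonian_cycle G (H i)) \<and>
     disjoint_family_on (\<lambda>i. walk_edges (H i)) {1..l} \<and>
     vertex_connectivity (del_edges G (\<Union>i\<in>{1..l}. walk_edges (H i))) = k"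
proof -
  interpret sw: dense_separation G S B A k d l by (rule swap)
  from matching_A obtain f where f: "inj_on f S" "\<And>s. s \<in> S \<Longrightarrow> f s \<in> A \<and> adj s (f s)"
    by blast
  from sw.matching_A obtain g where g: "inj_on g S" "\<And>s. s \<in> S \<Longrightarrow> g s \<in> B \<and> adj s (g s)"
    by blast
  have fA: "\<forall>s\<in>S. f s \<in> A" and gB: "\<forall>s\<in>S. g s \<in> B" using f(2) g(2) by blast+
  from hamiltonian_cycles_avoiding_matchings[OF f(1) fA g(1) gB]
  obtain vs where vs: "\<forall>i<l. distinct (vs i) \<and> set (vs i) = pverts G
      \<and> successively adj (vs i @ [hd (vs i)]) \<and> 3 \<le> length (vs i)
      \<and> (\<forall>s\<in>S. {s, f s} \<notin> walk_edges (closed_walk (vs i)) \<and> {s, g s} \<notin> walk_edges (closed_walk (vs i)))"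
    and dis: "disjoint_family_on (\<lambda>i. walk_edges (closed_walk (vs i))) {..<l}"
    by (elim exE conjE)
  define W where "W i = walk_edges (closed_walk (vs i))" for i
  define F where "F = (\<Union>i<l. W i)"
  have "finite {u. {v, u} \<in> F} \<and> card {u. {v, u} \<in> F} \<le> 2 * l" for v
  proof -
    have eq: "{u. {v, u} \<in> F} = (\<Union>i<l. {u. {v, u} \<in> W i})" by (auto simp: F_def)
    have W: "finite {u. {v, u} \<in> W i}" "card {u. {v, u} \<in> W i} \<le> 2" if "i < l" for i
      using closed_walk_neighbours[of "vs i"] vs that unfolding W_def by simp_all
    have "card (\<Union>i<l. {u. {v, u} \<in> W i}) \<le> (\<Sum>i<l. card {u. {v, u} \<in> W i})"
      by (rule card_UN_le) simp
    also have "\<dots> \<le> (\<Sum>i<l. 2)" by (intro sum_mono W) simp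
    finally show ?thesis using W(1) unfolding eq by simp
  qed
  moreover have "{s, f s} \<notin> F \<and> {s, g s} \<notin> F" if "s \<in> S" for s
    using vs that unfolding F_def W_def by blast
  ultimately have con: "vertex_connectivity (del_edges G F) = k"
    by (intro vertex_connectivity_del_edges[of f F g] f(1) g(1)) (simp_all add: f(2) g(2))
  \<comment> \<open>The statement numbers the cycles from 1, the construction from 0.\<close>
  have F: "(\<Union>i\<in>{1..l}. W (i - 1)) = F"
    unfolding F_def image_Suc_lessThan[symmetric] by simp
  have "hamiltonian_cycle G (closed_walk (vs (i - 1)))" if "i \<in> {1..l}" for i
  proof -
    have "i - 1 < l" using that by auto
    with vs show ?thesis
      by (intro hamiltonian_cycle_closed_walk[OF graph]) (simp_all add: adj_def[abs_def])
  qed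
  moreover have "disjoint_family_on (\<lambda>i. W (i - 1)) {1..l}"
    unfolding disjoint_family_on_def
  proof (intro ballI impI)
    fix i j assume "i \<in> {1..l}" "j \<in> {1..l}" "i \<noteq> j"
    then have "i - 1 \<in> {..<l}" "j - 1 \<in> {..<l}" "i - 1 \<noteq> j - 1" by auto
    then show "W (i - 1) \<inter> W (j - 1) = {}"
      using dis unfolding disjoint_family_on_def W_def by blast
  qed
  ultimately show ?thesis using con unfolding F[symmetric] W_def
    by (intro exI[of _ "\<lambda>i. closed_walk (vs (i - 1))"] conjI ballI)
qed

end

theorem theorem6:
  fixes G :: "'a pair_pre_digraph" and l n k :: nat
  assumes "l \<ge> 1"
    and "pair_graph G"
    and "n = card (pverts G)"
    and "k = vertex_connectivity G"
    and "int n \<ge> max (2 * int k * int l + int k - 2 * int l + 1)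
                      (6 * int k + 8 * int l - 4 - 2 * \<lceil>(real k - 2) / real k\<rceil>)"
    and "real (min_degree G) \<ge> real n / 2"
  shows "\<exists>H :: nat \<Rightarrow> ('a \<times> 'a) awalk.
           (\<forall>i\<in>{1..l}. hamiltonian_cycle G (H i)) \<and>
           disjoint_family_on (\<lambda>i. walk_edges (H i)) {1..l} \<and>
           vertex_connectivity (del_edges G (\<Union>i\<in>{1..l}. walk_edges (H i))) = vertex_connectivity G"
proof -
  interpret pair_graph G by fact
  \<comment> \<open>The quotient is 0 for \<open>k = 0\<close> by the convention on division. With
    the ceiling at most 1, the second bound gives \<open>n \<ge> 6 * k + 8 * l - 6\<close>.\<close>
  have "(real k - 2) / real k \<le> 1" by (cases "k = 0") (auto simp: field_simps)
  then have c: "\<lceil>(real k - 2) / real k\<rceil> \<le> 1" by simp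
  have n: "2 * int k * int l + int k - 2 * int l + 1 \<le> int n"
    "6 * int k + 8 * int l - 4 - 2 * \<lceil>(real k - 2) / real k\<rceil> \<le> int n"
    using assms(5) unfolding max.bounded_iff by blast+
  have "int (2 * k * l + k + 1) \<le> int (n + 2 * l)" using n(1) by simp
  then have n1: "2 * k * l + k + 1 \<le> card (pverts G) + 2 * l"
    unfolding assms(3)[symmetric] by (simp only: of_nat_le_iff)
  have n2: "6 * k + 8 * l \<le> card (pverts G) + 6"
    using n(2) c unfolding assms(3)[symmetric] by linarith
  have n_le: "card (pverts G) \<le> 2 * min_degree G" using assms(6) unfolding assms(3) by linarith
  have "vertex_connectivity G + 1 < card (pverts G)"
    using n2 assms(1) unfolding assms(4)[symmetric] by linarith
  then obtain S A B where S: "S \<subseteq> pverts G" "card S = k" "separates G S A B"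
    unfolding assms(4) by (rule vertex_connectivity_witness[OF pair_sym_arcs pair_finite_verts])
  have conn: "\<not> separates G T C D" if "T \<subseteq> pverts G" "card T < k" for T C D
    using vertex_connectivity_le_separator[OF pair_sym_arcs that(1)] that(2) assms(4) by fastforce
  interpret dense_separation G S A B k "min_degree G" l
    by (intro dense_separation.intro assms(1,2) S min_degree_le n_le n1 n2 conn)
  show ?thesis using hamiltonian_cycles_preserving_connectivity unfolding assms(4)[symmetric] .
qed

end
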